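(* Let $X$ be an upwards skip-free Lévy chain on $\mathbb{Z}_h$ and let $$W(x):=1\Big/\prod_{r=1}^{\lfloor x/h\rfloor}\mathsf{P}(D_1\le(r-1)h)\qquad(x\ge0)$$ (defined up to a multiplicative constant). For every $y\in\mathbb{Z}_h^+$ and $x\ge0$ one has $$\mathsf{P}(\underline{X}_{T_y}\ge-x)=\frac{W(x)}{W(x+y)},$$ and $W:[0,\infty)\to[0,\infty)$ is (up to a multiplicative constant) the unique right-continuous and piecewise continuous function of exponential order with Laplace transform $$\hat W(\beta)=\int_0^\infty e^{-\beta x}W(x)\,dx=\frac{e^{\beta h}-1}{\beta h\psi(\beta)}\qquad(\beta>\Phi(0)).$$
   Context: Fix $h>0$; $\mathbb{Z}_h:=\{hk:k\in\mathbb{Z}\}$, $\mathbb{Z}_h^+:=\mathbb{Z}_h\cap[0,\infty)$. $X$ is a Lévy process (càdlàg paths, $X_0=0$ a.s.) on a filtered probability space $(\Omega,\mathcal{F},\mathbb{F},\mathsf{P})$ satisfying the usual conditions, adapted to $\mathbb{F}$ and with independent increments relative to $\mathbb{F}$. It is an upwards skip-free Lévy chain: a compound Poisson process (finite Lévy measure $\lambda$, no drift, no Gaussian part) with $\lambda$ supported in $\mathbb{Z}_h$ and with $\lambda|_{(0,\infty)}$ having support exactly $\{h\}$ (so $\lambda(\{h\})>0$). $\psi(\beta)=\int_{\mathbb{R}}(e^{\beta x}-1)\lambda(dx)$ is the Laplace exponent, $\mathsf{E}[e^{\beta X_t}]=e^{t\psi(\beta)}$, $\beta\ge0$. $\psi$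 is strictly convex and continuous on $[0,\infty)$ and tends to $+\infty$; $\Phi(0)$ is the largest root of $\psi|_{[0,\infty)}$. $T_x:=\inf\{t\ge0:X_t\ge x\}$ ($\inf\emptyset=+\infty$), $\underline{X}_t:=\inf\{X_s:s\in[0,t]\}$, $\underline{X}_\infty:=\inf\{X_s:s\ge0\}$. $D_1$ is the depth (possibly zero or infinite) of the excursion of $X$ below its initial maximum $0$ until the next new maximum $h$ is attained, i.e. $D_1=-\underline{X}_{T_h}$ (which is a.s. $+\infty$ on $\{T_h=\infty\}$). A function $f:[0,\infty)\to[0,\infty)$ is of exponential order if there are $\alpha,A\ge0$ with $f(x)\le Ae^{\alpha x}$ for all $x\ge0$. "Up to a multiplicative constant" means: for a suitable positive constant multiple of $W$ the displayed Laplace transform identity holds, and that multiple is the only function in the stated class with this Laplace transform. *)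

theory Defs
  imports "HOL-Probability.Probability"
begin

text \<open>The time set is the half-line of nonnegative reals; filtrations and processes are indexed by
  \<^typ>\<open>real\<close>, and their values at negative times are unconstrained and never used.\<close>

locale filtered_prob_space = prob_space M for M :: "'a measure" +
  fixes F :: "real \<Rightarrow> 'a measure"
  assumes subalgebra_F: "\<And>t. 0 \<le> t \<Longrightarrow> subalgebra M (F t)"
    and F_mono: "\<And>s t. 0 \<le> s \<Longrightarrow> s \<le> t \<Longrightarrow> sets (F s) \<subseteq> sets (F t)"

text \<open>The first assumption puts every subset of a null set of M into the initial sigma-algebra; in
  particular M itself is complete.\<close>

locale usual_conditions = filtered_prob_space +
  assumes null_sets_F: "\<And>N. N \<in> null_sets (completion M) \<Longrightarrow> N \<in> sets (F 0)"
    and F_right_continuous: "\<And>t. 0 \<le> t \<Longrightarrow> sets (F t) = (\<Inter>s\<in>{t<..}. sets (F s))"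

definition cadlag :: "(real \<Rightarrow> real) \<Rightarrow> bool" where
  "cadlag x \<longleftrightarrow>
     (\<forall>t\<ge>0. continuous (at_right t) x) \<and> (\<forall>t>0. \<exists>l. (x \<longlongrightarrow> l) (at_left t))"

text \<open>Stochastic continuity is not listed: it follows from the cadlag paths together with
  stationarity of the increments.\<close>

locale levy_process = usual_conditions +
  fixes X :: "real \<Rightarrow> 'a \<Rightarrow> real"
  assumes X_zero: "AE \<omega> in M. X 0 \<omega> = 0"
    and X_cadlag: "\<And>\<omega>. \<omega> \<in> space M \<Longrightarrow> cadlag (\<lambda>t. X t \<omega>)"
    and X_adapted: "\<And>t. 0 \<le> t \<Longrightarrow> X t \<in> borel_measurable (F t)"
    and X_indep_increments: "\<And>s t. 0 \<le> s \<Longrightarrow> s \<le> t \<Longrightarrow>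
      indep_set (sets (F s)) {(\<lambda>\<omega>. X t \<omega> - X s \<omega>) -` B \<inter> space M | B. B \<in> sets borel}"
    and X_stationary_increments: "\<And>s t. 0 \<le> s \<Longrightarrow> s \<le> t \<Longrightarrow>
      distr M borel (\<lambda>\<omega>. X t \<omega> - X s \<omega>) = distr M borel (X (t - s))"

text \<open>A compound Poisson process is a Levy process with finite Levy measure \<open>lam\<close>, no drift and no
  Gaussian part. This is the Levy-Khintchine formula for such a characteristic triplet, the
  drift being taken relative to the zero cut-off function.\<close>

locale compound_poisson_process = levy_process +
  fixes lam :: "real measure"
  assumes finite_lam: "finite_measure lam"
    and sets_lam: "sets lam = sets borel"
    and lam_zero: "emeasure lam {0} = 0"
    and char_X: "\<And>t p. 0 \<le> t \<Longrightarrow>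
      char (distr M borel (X t)) p = exp (complex_of_real t * (CLINT x|lam. iexp (p * x) - 1))"

text \<open>Topological support of a measure, relative to the subspace topology of its space.\<close>

definition measure_support :: "'b::topological_space measure \<Rightarrow> 'b set" where
  "measure_support \<mu> =
     {x \<in> space \<mu>. \<forall>U. open U \<longrightarrow> x \<in> U \<longrightarrow> 0 < emeasure \<mu> (U \<inter> space \<mu>)}"

definition lattice :: "real \<Rightarrow> real set" where
  "lattice h = {h * of_int k | k. True}"

definition lattice_nonneg :: "real \<Rightarrow> real set" where
  "lattice_nonneg h = lattice h \<inter> {0..}"

locale upwards_skip_free_levy_chain = compound_poisson_process +
  fixes h :: real
  assumes h_pos: "0 < h"
    and lam_lattice: "measure_support lam \<subseteq> lattice h"
    and lam_upward: "measure_support (restrict_space lam {0<..}) = {h}"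

definition laplace_exponent :: "real measure \<Rightarrow> real \<Rightarrow> real" where
  "laplace_exponent lam \<beta> = (LINT x|lam. exp (\<beta> * x) - 1)"

definition Phi0 :: "real measure \<Rightarrow> real" where
  "Phi0 lam = (GREATEST \<beta>. 0 \<le> \<beta> \<and> laplace_exponent lam \<beta> = 0)"

text \<open>Infima are taken in the extended reals, so that the infimum of the empty set is \<open>\<infinity>\<close>.\<close>

definition passage_time :: "(real \<Rightarrow> 'a \<Rightarrow> real) \<Rightarrow> real \<Rightarrow> 'a \<Rightarrow> ereal" where
  "passage_time X x \<omega> = (INF t\<in>{t. 0 \<le> t \<and> x \<le> X t \<omega>}. ereal t)"

text \<open>The running infimum at an extended time \<open>\<tau>\<close>; for \<open>\<tau> = \<infinity>\<close> it is the overall infimum.\<close>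

definition running_inf :: "(real \<Rightarrow> 'a \<Rightarrow> real) \<Rightarrow> ereal \<Rightarrow> 'a \<Rightarrow> ereal" where
  "running_inf X \<tau> \<omega> = (INF s\<in>{s. 0 \<le> s \<and> ereal s \<le> \<tau>}. ereal (X s \<omega>))"

definition first_excursion_depth :: "(real \<Rightarrow> 'a \<Rightarrow> real) \<Rightarrow> real \<Rightarrow> 'a \<Rightarrow> ereal" where
  "first_excursion_depth X h \<omega> = - running_inf X (passage_time X h \<omega>) \<omega>"

text \<open>The scale function, in the normalization with value 1 at the origin.\<close>

definition scale_function ::
  "'a measure \<Rightarrow> (real \<Rightarrow> 'a \<Rightarrow> real) \<Rightarrow> real \<Rightarrow> real \<Rightarrow> real" where
  "scale_function M X h x =
     1 / (\<Prod>r = 1..nat \<lfloor>x / h\<rfloor>.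
            measure M {\<omega> \<in> space M. first_excursion_depth X h \<omega> \<le> ereal ((real r - 1) * h)})"

text \<open>Functions on the nonnegative half-line are represented by functions on the reals, whose values
  at negative arguments play no role.\<close>

definition exponential_order :: "(real \<Rightarrow> real) \<Rightarrow> bool" where
  "exponential_order f \<longleftrightarrow> (\<exists>\<alpha>\<ge>0. \<exists>A\<ge>0. \<forall>x\<ge>0. f x \<le> A * exp (\<alpha> * x))"

text \<open>Finitely many discontinuities in each bounded interval, all with finite one-sided limits.\<close>

definition piecewise_continuous :: "(real \<Rightarrow> real) \<Rightarrow> bool" where
  "piecewise_continuous f \<longleftrightarrow>
     (\<forall>b. finite {x \<in> {0..b}. \<not> continuous (at x within {0..}) f}) \<and>
     (\<forall>x\<ge>0. \<exists>l. (f \<longlongrightarrow> l) (at_right x)) \<and>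
     (\<forall>x>0. \<exists>l. (f \<longlongrightarrow> l) (at_left x))"

definition scale_class :: "(real \<Rightarrow> real) set" where
  "scale_class = {f. (\<forall>x\<ge>0. 0 \<le> f x) \<and> (\<forall>x\<ge>0. continuous (at_right x) f) \<and>
     piecewise_continuous f \<and> exponential_order f}"

definition has_laplace_transform :: "(real \<Rightarrow> real) \<Rightarrow> real \<Rightarrow> real \<Rightarrow> bool" where
  "has_laplace_transform f \<beta> v \<longleftrightarrow>
     set_integrable lborel {0..} (\<lambda>x. exp (- \<beta> * x) * f x) \<and>
     (LBINT x:{0..}. exp (- \<beta> * x) * f x) = v"

end

theory Submission
  imports Defs
begin

text \<open>Write the jumps of the chain as \<open>h (1 - D)\<close> with a random natural number \<open>D\<close>, and let \<open>w\<close> be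
  the solution, normalized by \<open>w 0 = 1\<close>, of \<open>E[w (n + 1 - D)] = w n\<close> with \<open>w = 0\<close> on the negative
  integers. Optional stopping of \<open>w (X / h)\<close> at the exit from a strip shows that, from level
  \<open>n h\<close>, the chain reaches \<open>(n + k) h\<close> before becoming negative with probability
  \<open>w n / w (n + k)\<close>. The case \<open>k = 1\<close> gives \<open>P(D\<^sub>1 \<le> n h) = w n / w (n + 1)\<close>, so the product
  defining \<open>W\<close> telescopes to \<open>w\<close>. Optional stopping is carried out on finer and finer time grids:
  one step of length \<open>\<delta>\<close> changes the expectation only by \<open>O(\<delta>\<^sup>2)\<close>, since harmonicity takes care of
  the paths with at most one jump.

  With \<open>G\<close> the probability generating function of \<open>D\<close>, the recursion for \<open>w\<close> reads
  \<open>(\<Sum>n. w n z^n) (G z - z) = G 0\<close>, and \<open>z = exp (- \<beta> h)\<close> turns \<open>G z - z\<close> into a multiple of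
  \<open>z \<psi>(\<beta>)\<close>; this is the Laplace transform of \<open>W\<close>. Uniqueness reduces to the determinacy of the
  moment problem on \<open>[0, 1]\<close> by the substitution \<open>u = exp (- x)\<close>.\<close>

section \<open>Uniqueness of Laplace transforms\<close>

text \<open>On \<open>[-1, 1]\<close> the characteristic function is an everywhere convergent power
  series whose coefficients are the moments, so Levy's uniqueness theorem applies.\<close>

lemma real_distribution_moments_unique:
  assumes M1: "real_distribution M1" "AE x in M1. \<bar>x\<bar> \<le> 1"
    and M2: "real_distribution M2" "AE x in M2. \<bar>x\<bar> \<le> 1"
    and eq: "\<And>n. (LINT x|M1. x ^ n) = (LINT x|M2. x ^ n)"
  shows "M1 = M2"
proof (rule Levy_uniqueness[OF M1(1) M2(1)])
  have char_sums: "(\<lambda>n. ((\<i> * of_real t) ^ n /\<^sub>R fact n) * of_real (LINT x|M. x ^ n)) sums char M t"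
    if M: "real_distribution M" "AE x in M. \<bar>x\<bar> \<le> 1" for M :: "real measure" and t
  proof -
    interpret real_distribution M by (rule M)
    let ?f = "\<lambda>n x. (\<i> * of_real (t * x)) ^ n /\<^sub>R fact n"
    have eqf: "?f n x = ((\<i> * of_real t) ^ n /\<^sub>R fact n) * of_real (x ^ n)" for n x
      by (simp add: power_mult_distrib)
    have int_pow: "integrable M (\<lambda>x. x ^ n)" for n
    proof (rule integrable_const_bound[where B=1])
      show "AE x in M. norm (x ^ n) \<le> 1"
        using M(2) by eventually_elim (simp add: power_abs power_le_one)
    qed simp
    have int: "integrable M (?f n)" for n
      unfolding eqf by (intro integrable_mult_right integrable_of_real int_pow)
    \<comment> \<open>Sum and integral are interchanged; \<open>\<bar>x\<bar> \<le> 1\<close> bounds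
      the integrated terms by those of the exponential series at
      \<open>\<bar>t\<bar>\<close>.\<close>
    have "(\<lambda>n. \<integral>x. ?f n x \<partial>M) sums (\<integral>x. (\<Sum>n. ?f n x) \<partial>M)"
    proof (rule sums_integral[OF int])
      have sn: "summable (\<lambda>n. \<bar>t * x\<bar> ^ n /\<^sub>R fact n)" for x
        by (rule summable_exp_generic)
      have nf: "norm (?f n x) = \<bar>t * x\<bar> ^ n /\<^sub>R fact n" for n x
        by (simp only: norm_scaleR norm_power norm_mult norm_ii norm_of_real) simp
      show "AE x in M. summable (\<lambda>n. norm (?f n x))"
        unfolding nf using sn by simp
      show "summable (\<lambda>n. \<integral>x. norm (?f n x) \<partial>M)"
      proof (rule summable_comparison_test')
        show "summable (\<lambda>n. \<bar>t\<bar> ^ n /\<^sub>R fact n)"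
          by (rule summable_exp_generic)
        fix n
        have "norm (\<integral>x. norm (?f n x) \<partial>M) = (\<integral>x. norm (?f n x) \<partial>M)"
          by simp
        also have "\<dots> \<le> (\<integral>x. \<bar>t\<bar> ^ n /\<^sub>R fact n \<partial>M)"
        proof (rule integral_mono_AE)
          show "AE x in M. norm (?f n x) \<le> \<bar>t\<bar> ^ n /\<^sub>R fact n"
            using M(2)
          proof eventually_elim
            case (elim x)
            then have "\<bar>t * x\<bar> ^ n \<le> \<bar>t\<bar> ^ n"
              by (intro power_mono) (auto simp: abs_mult mult_left_le)
            then show ?case unfolding nf by (simp add: divide_right_mono)
          qed
        qed (use integrable_norm[OF int] in blast, simp)
        finally show "norm (\<integral>x. norm (?f n x) \<partial>M) \<le> \<bar>t\<bar> ^ n /\<^sub>R fact n"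
          using prob_space by simp
      qed
    qed
    moreover have "(\<Sum>n. ?f n x) = iexp (t * x)" for x
      using exp_converges[of "\<i> * of_real (t * x)"] by (rule sums_unique[symmetric])
    moreover have "(\<integral>x. ?f n x \<partial>M) = ((\<i> * of_real t) ^ n /\<^sub>R fact n) * of_real (LINT x|M. x ^ n)" for n
      unfolding eqf by (simp only: integral_mult_right_zero integral_complex_of_real)
    ultimately show ?thesis unfolding char_def by simp
  qed
  show "char M1 = char M2"
  proof
    fix t
    show "char M1 t = char M2 t"
      using char_sums[OF M1, of t] char_sums[OF M2, of t] unfolding eq by (rule sums_unique2)
  qed
qed

text \<open>Nonnegativity lets the weighted functions serve as densities. The transforms at
  \<open>b + 1 + n\<close> are then, up to the total mass, the moments of the images of these
  measures under \<open>exp (- x)\<close>, so the images coincide.\<close>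

lemma laplace_unique_AE:
  fixes f g :: "real \<Rightarrow> real"
  assumes nn: "\<And>x. 0 \<le> x \<Longrightarrow> 0 \<le> f x" "\<And>x. 0 \<le> x \<Longrightarrow> 0 \<le> g x"
    and f: "\<And>\<beta>. b < \<beta> \<Longrightarrow> set_integrable lborel {0..} (\<lambda>x. exp (- \<beta> * x) * f x)"
    and g: "\<And>\<beta>. b < \<beta> \<Longrightarrow> set_integrable lborel {0..} (\<lambda>x. exp (- \<beta> * x) * g x)"
    and eq: "\<And>\<beta>. b < \<beta> \<Longrightarrow> (LBINT x:{0..}. exp (- \<beta> * x) * f x) = (LBINT x:{0..}. exp (- \<beta> * x) * g x)"
  shows "AE x in lborel. 0 \<le> x \<longrightarrow> f x = g x"
proof -
  \<comment> \<open>The weight with exponent \<open>b + 1\<close> puts already the moment of order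
    zero inside the range where the transforms exist.\<close>
  define ph where "ph f x = indicator {0..} x * (exp (- (b + 1) * x) * f x)" for f and x :: real
  define c where "c = (LINT x|lborel. ph f x)"
  have int: "integrable lborel (ph f)" "integrable lborel (ph g)"
    using f[of "b+1"] g[of "b+1"] unfolding ph_def[abs_def] set_integrable_def by simp_all
  have mom: "(LINT x|lborel. exp (- x) ^ n * ph f x) = (LINT x|lborel. exp (- x) ^ n * ph g x)" for n :: nat
  proof -
    have "exp (- x) ^ n * ph k x = indicator {0..} x * (exp (- (b + 1 + n) * x) * k x)" for k x
      unfolding ph_def by (simp add: exp_of_nat_mult[symmetric] mult_exp_exp algebra_simps)
    then show ?thesis using eq[of "b+1+n"] by (simp add: set_lebesgue_integral_def)
  qed
  have c2: "c = (LINT x|lborel. ph g x)" using mom[of 0] by (simp add: c_def)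
  have pnn: "0 \<le> ph f x" "0 \<le> ph g x" for x
    using nn by (auto simp: ph_def split: split_indicator)
  have c0: "0 \<le> c" unfolding c_def by (rule Bochner_Integration.integral_nonneg) (rule pnn)
  have "AE x in lborel. ph f x = ph g x"
  \<comment> \<open>Normalization divides by the common total mass \<open>c\<close>; if it is zero,
    both functions vanish almost everywhere.\<close>
  proof (cases "c = 0")
    case True
    then have "AE x in lborel. ph f x = 0" "AE x in lborel. ph g x = 0"
      using integral_nonneg_eq_0_iff_AE[OF int(1)] integral_nonneg_eq_0_iff_AE[OF int(2)] pnn c_def c2 by auto
    then show ?thesis by eventually_elim simp
  next
    case False
    with c0 have c: "0 < c" by simp
    define N where "N k = density lborel (\<lambda>x. ennreal (ph k x / c))" for k
    define D where "D k = distr (N k) borel (\<lambda>x. exp (- x))" for k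
    \<comment> \<open>The last of these facts recovers \<open>N k\<close> from its image
      \<open>D k\<close>: the substitution is injective, with inverse \<open>- ln u\<close>.\<close>
    have *: "real_distribution (D k)" "AE u in D k. \<bar>u\<bar> \<le> 1"
        "\<And>n. (LINT u|D k. u ^ n) = (LINT x|lborel. exp (- x) ^ n * ph k x) / c"
        "\<And>A. A \<in> sets borel \<Longrightarrow> emeasure (N k) A = emeasure (D k) {u. 0 < u \<and> - ln u \<in> A}"
      if i[measurable]: "integrable lborel (ph k)" and p: "\<And>x. 0 \<le> ph k x" and ck: "c = (LINT x|lborel. ph k x)" for k
    proof -
      have m[measurable]: "(\<lambda>x. exp (- x)) \<in> measurable (N k) borel"
        unfolding N_def by simp
      have mk[measurable]: "ph k \<in> borel_measurable borel"
        using borel_measurable_integrable[OF i] by simp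
      have sp: "space (N k) = UNIV" "sets (N k) = sets borel" by (simp_all add: N_def)
      have "emeasure (N k) (space (N k)) = ennreal (LINT x|lborel. ph k x / c)"
        unfolding N_def by (subst nn_integral_eq_integral[symmetric])
          (use i p c in \<open>auto simp: emeasure_density\<close>)
      also have "\<dots> = 1" using c ck by simp
      finally interpret N: prob_space "N k" by (rule prob_spaceI)
      show "real_distribution (D k)"
        unfolding D_def by (rule N.real_distribution_distr) simp
      have "AE x in N k. 0 \<le> x"
        unfolding N_def by (subst AE_density) (measurable, auto simp: ph_def split: split_indicator)
      then show "AE u in D k. \<bar>u\<bar> \<le> 1"
        unfolding D_def by (subst AE_distr_iff) auto
      show "(LINT u|D k. u ^ n) = (LINT x|lborel. exp (- x) ^ n * ph k x) / c" for n
        unfolding D_def using c p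
        by (simp add: integral_distr N_def integral_real_density mult.commute)
      fix A :: "real set" assume [measurable]: "A \<in> sets borel"
      have "emeasure (D k) {u. 0 < u \<and> - ln u \<in> A} =
          emeasure (N k) ((\<lambda>x. exp (- x)) -` {u. 0 < u \<and> - ln u \<in> A} \<inter> space (N k))"
        unfolding D_def by (rule emeasure_distr) auto
      also have "(\<lambda>x. exp (- x)) -` {u. 0 < u \<and> - ln u \<in> A} \<inter> space (N k) = A"
        using sp by auto
      finally show "emeasure (N k) A = emeasure (D k) {u. 0 < u \<and> - ln u \<in> A}" by simp
    qed
    note F = *[OF int(1) pnn(1) c_def] and G = *[OF int(2) pnn(2) c2]
    have "D f = D g"
      by (rule real_distribution_moments_unique[OF F(1,2) G(1,2)]) (simp only: F(3) G(3) mom)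
    then have "N f = N g"
      by (intro measure_eqI) (auto simp: F(4) G(4) N_def[THEN arg_cong[where f=sets], simplified])
    moreover have "(\<lambda>x. ennreal (ph f x / c)) \<in> borel_measurable lborel"
        "(\<lambda>x. ennreal (ph g x / c)) \<in> borel_measurable lborel"
      using int by (auto intro!: borel_measurable_integrable)
    ultimately have "AE x in lborel. ennreal (ph f x / c) = ennreal (ph g x / c)"
      using sigma_finite_measure.density_unique_iff[OF sigma_finite_lborel] unfolding N_def by blast
    then show ?thesis
      by eventually_elim (use pnn c in \<open>simp add: ennreal_inj\<close>)
  qed
  then show ?thesis
    by eventually_elim (auto simp: ph_def split: split_indicator_asm)
qed

text \<open>A difference at \<open>x\<close> would persist, by right continuity, on an interval to
  the right of \<open>x\<close>, which has positive Lebesgue measure.\<close>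

lemma AE_eq_right_continuous_imp_eq:
  fixes f g :: "real \<Rightarrow> real"
  assumes ae: "AE x in lborel. a \<le> x \<longrightarrow> f x = g x"
    and f: "continuous (at_right x) f" and g: "continuous (at_right x) g" and x: "a \<le> x"
  shows "f x = g x"
proof (rule ccontr)
  assume "f x \<noteq> g x"
  moreover have "((\<lambda>t. f t - g t) \<longlongrightarrow> f x - g x) (at_right x)"
    using f g by (intro tendsto_diff) (auto simp: continuous_within)
  ultimately have "eventually (\<lambda>t. f t - g t \<noteq> 0) (at_right x)"
    by (intro tendsto_imp_eventually_ne) auto
  then obtain b where b: "x < b" "\<And>t. x < t \<Longrightarrow> t < b \<Longrightarrow> f t \<noteq> g t"
    by (auto simp: eventually_at_right_field)
  have "AE t in lborel. t \<notin> {x<..<b}"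
    using ae by eventually_elim (use b x in auto)
  then have "emeasure lborel {x<..<b} = 0"
    by (subst (asm) AE_iff_measurable[of "{x<..<b}"]) auto
  with b(1) show False by simp
qed

section \<open>Lattice compound Poisson distributions\<close>

lemma integrable_pmf_bounded:
  fixes f :: "'b \<Rightarrow> 'c::{banach, second_countable_topology}"
  assumes "\<And>y. norm (f y) \<le> B"
  shows "integrable (measure_pmf p) f"
  using assms by (intro measure_pmf.integrable_const_bound[where B=B]) auto

text \<open>Adding the bound \<open>B\<close> makes the function nonnegative, so the corresponding
  rule for nonnegative integrals applies; the constant cancels afterwards.\<close>

lemma integral_bind_pmf_bounded_real:
  fixes f :: "'b \<Rightarrow> real"
  assumes f: "\<And>y. \<bar>f y\<bar> \<le> B"
  shows "(LINT y|bind_pmf p q. f y) = (LINT x|p. LINT y|q x. f y)"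
proof -
  have B: "0 \<le> B" using f[of undefined] by linarith
  note int = integrable_pmf_bounded[where 'c=real, simplified]
  have inner: "\<bar>LINT y|q x. f y\<bar> \<le> B" for x
    by (intro order.trans[OF integral_abs_bound] measure_pmf.integral_le_const)
       (use f int[of "\<lambda>y. \<bar>f y\<bar>" B] in auto)
  define g where "g y = f y + B" for y
  have g: "0 \<le> g y" "\<bar>g y\<bar> \<le> 2 * B" for y using f[of y] by (auto simp: g_def)
  have gi: "(LINT y|q x. g y) = (LINT y|q x. f y) + B" for x
    unfolding g_def by (subst Bochner_Integration.integral_add) (use int[of f B] f in auto)
  have "ennreal (LINT y|bind_pmf p q. g y) = (\<integral>\<^sup>+y. g y \<partial>bind_pmf p q)"
    using int[of g] g by (intro nn_integral_eq_integral[symmetric]) auto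
  also have "\<dots> = (\<integral>\<^sup>+x. ennreal (LINT y|q x. g y) \<partial>p)"
    unfolding nn_integral_bind_pmf
    by (intro nn_integral_cong nn_integral_eq_integral) (use int[of g] g in auto)
  also have "\<dots> = ennreal (LINT x|p. LINT y|q x. g y)"
  proof (intro nn_integral_eq_integral)
    have "\<bar>LINT y|q x. g y\<bar> \<le> 2 * B" for x using inner[of x] unfolding gi by linarith
    then show "integrable (measure_pmf p) (\<lambda>x. LINT y|q x. g y)" by (rule int)
  qed (use g in auto)
  finally have "(LINT y|bind_pmf p q. g y) = (LINT x|p. LINT y|q x. g y)"
    using g by (subst (asm) ennreal_inj) auto
  moreover have "(LINT y|bind_pmf p q. g y) = (LINT y|bind_pmf p q. f y) + B"
    unfolding g_def by (subst Bochner_Integration.integral_add) (use int[of f B] f in auto)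
  moreover have "(LINT x|p. LINT y|q x. g y) = (LINT x|p. LINT y|q x. f y) + B"
    unfolding gi by (subst Bochner_Integration.integral_add) (use int[OF inner] in auto)
  ultimately show ?thesis by simp
qed

lemma integral_bind_pmf_bounded_complex:
  fixes f :: "'b \<Rightarrow> complex"
  assumes f: "\<And>y. norm (f y) \<le> B"
  shows "(LINT y|bind_pmf p q. f y) = (LINT x|p. LINT y|q x. f y)"
proof -
  note int = integrable_pmf_bounded
  have inner: "norm (LINT y|q x. f y) \<le> B" for x
    by (intro order.trans[OF integral_norm_bound] measure_pmf.integral_le_const)
       (use f int[of "\<lambda>y. norm (f y)" B] in auto)
  have i1: "integrable (measure_pmf r) f" for r by (rule int[OF f])
  have i2: "integrable (measure_pmf p) (\<lambda>x. LINT y|q x. f y)" by (rule int[OF inner])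
  show ?thesis
  proof (rule complex_eqI)
    show "Re (LINT y|bind_pmf p q. f y) = Re (LINT x|p. LINT y|q x. f y)"
      using integral_bind_pmf_bounded_real[of "\<lambda>y. Re (f y)" B p q] order.trans[OF abs_Re_le_cmod f]
      by (simp add: integral_Re[OF i1] integral_Re[OF i2])
    show "Im (LINT y|bind_pmf p q. f y) = Im (LINT x|p. LINT y|q x. f y)"
      using integral_bind_pmf_bounded_real[of "\<lambda>y. Im (f y)" B p q] order.trans[OF abs_Im_le_cmod f]
      by (simp add: integral_Im[OF i1] integral_Im[OF i2])
  qed
qed

lemma expectation_nat_pmf_sums:
  fixes f :: "nat \<Rightarrow> 'b::{banach, second_countable_topology}"
  assumes f: "\<And>n. norm (f n) \<le> B"
  shows "(\<lambda>n. pmf p n *\<^sub>R f n) sums (LINT n|p. f n)"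
proof -
  have i: "integrable (measure_pmf p) f"
    using f by (intro measure_pmf.integrable_const_bound[where B=B]) auto
  then have "integrable (count_space UNIV) (\<lambda>n. pmf p n *\<^sub>R f n)"
    unfolding measure_pmf_eq_density by (subst (asm) integrable_density) auto
  from sums_integral_count_space_nat[OF this] show ?thesis
    unfolding measure_pmf_eq_density by (subst integral_density) auto
qed

text \<open>A jump is \<open>1 - d\<close> lattice steps, where \<open>d\<close> is a natural number drawn from \<open>Q\<close>; this encodes
  that the chain is skip-free upwards.\<close>

primrec jump_sum_pmf :: "nat pmf \<Rightarrow> nat \<Rightarrow> int pmf" where
  "jump_sum_pmf Q 0 = return_pmf 0"
| "jump_sum_pmf Q (Suc n) = bind_pmf Q (\<lambda>d. map_pmf (\<lambda>s. 1 - int d + s) (jump_sum_pmf Q n))"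

definition compound_poisson_pmf :: "nat pmf \<Rightarrow> real \<Rightarrow> int pmf" where
  "compound_poisson_pmf Q r = bind_pmf (poisson_pmf r) (jump_sum_pmf Q)"

text \<open>The steps are independent and identically distributed, so each contributes one
  factor.\<close>

lemma char_jump_sum_pmf:
  "(LINT i|jump_sum_pmf Q n. iexp (p * of_int i)) = (LINT d|Q. iexp (p * (1 - real d))) ^ n"
proof (induction n)
  case (Suc n)
  have "(LINT i|jump_sum_pmf Q (Suc n). iexp (p * of_int i)) =
      (LINT d|Q. LINT s|jump_sum_pmf Q n. iexp (p * (1 - real d)) * iexp (p * of_int s))"
  proof -
    have "(LINT i|jump_sum_pmf Q (Suc n). iexp (p * of_int i)) =
        (LINT d|Q. LINT i|map_pmf (\<lambda>s. 1 - int d + s) (jump_sum_pmf Q n). iexp (p * of_int i))"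
      unfolding jump_sum_pmf.simps by (rule integral_bind_pmf_bounded_complex[where B=1]) simp
    also have "\<dots> = (LINT d|Q. LINT s|jump_sum_pmf Q n. iexp (p * (1 - real d)) * iexp (p * of_int s))"
      unfolding integral_map_pmf exp_add[symmetric]
      by (intro Bochner_Integration.integral_cong refl arg_cong[where f=exp]) (simp add: algebra_simps)
    finally show ?thesis .
  qed
  also have "\<dots> = (LINT d|Q. iexp (p * (1 - real d)) * (LINT s|jump_sum_pmf Q n. iexp (p * of_int s)))"
    by (simp only: integral_mult_right_zero)
  also have "\<dots> = (LINT d|Q. iexp (p * (1 - real d))) * (LINT s|jump_sum_pmf Q n. iexp (p * of_int s))"
    by (simp only: integral_mult_left_zero)
  finally show ?case using Suc by simp
qed simp

text \<open>The argument is complex because it will be the characteristic function of a single jump,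
  whose modulus is at most one.\<close>

lemma poisson_generating_function:
  fixes z :: complex
  assumes r: "0 < r" and z: "norm z \<le> 1"
  shows "(LINT n|poisson_pmf r. z ^ n) = exp (of_real r * (z - 1))"
proof -
  have "(\<lambda>n. pmf (poisson_pmf r) n *\<^sub>R z ^ n) sums (LINT n|poisson_pmf r. z ^ n)"
    using z by (intro expectation_nat_pmf_sums[where B=1]) (simp add: norm_power power_le_one)
  moreover have "pmf (poisson_pmf r) n *\<^sub>R z ^ n = exp (- of_real r) * ((of_real r * z) ^ n /\<^sub>R fact n)" for n
    using r by (simp add: scaleR_conv_of_real power_mult_distrib exp_of_real[symmetric] field_simps)
  moreover have "(\<lambda>n. exp (- of_real r) * ((of_real r * z) ^ n /\<^sub>R fact n)) sums
      (exp (- of_real r) * exp (of_real r * z))"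
    by (intro sums_mult exp_converges)
  ultimately have "(LINT n|poisson_pmf r. z ^ n) = exp (- of_real r) * exp (of_real r * z)"
    using sums_unique2 by auto
  then show ?thesis by (simp add: exp_add[symmetric] algebra_simps)
qed

lemma char_compound_poisson_pmf:
  fixes Q :: "nat pmf"
  assumes "0 < r"
  shows "char (distr (compound_poisson_pmf Q r) borel (\<lambda>i. h * of_int i)) p =
    exp (of_real r * ((LINT d|Q. iexp (p * (h * (1 - real d)))) - 1))"
proof -
  have i: "integrable (measure_pmf Q) (\<lambda>d. iexp (p * (h * (1 - real d))))"
    by (intro measure_pmf.integrable_const_bound[where B=1]) auto
  have n: "norm (LINT d|Q. iexp (p * (h * (1 - real d)))) \<le> 1"
    by (rule order.trans[OF integral_norm_bound]) simp
  have "char (distr (compound_poisson_pmf Q r) borel (\<lambda>i. h * of_int i)) p =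
      (LINT i|compound_poisson_pmf Q r. iexp (p * (h * of_int i)))"
    unfolding char_def by (subst integral_distr) auto
  also have "\<dots> = (LINT n|poisson_pmf r. LINT i|jump_sum_pmf Q n. iexp ((p * h) * of_int i))"
    unfolding compound_poisson_pmf_def by (subst integral_bind_pmf_bounded_complex[where B=1]) (auto simp: mult.assoc)
  also have "\<dots> = exp (of_real r * ((LINT d|Q. iexp (p * h * (1 - real d))) - 1))"
    unfolding char_jump_sum_pmf
    using n by (intro poisson_generating_function assms) (simp add: mult.assoc)
  finally show ?thesis by (simp add: mult.assoc)
qed

text \<open>This follows from \<open>exp (- r) \<ge> 1 - r\<close>. The quadratic order is what
  makes the errors of all grid steps negligible in total.\<close>

lemma poisson_two_or_more:
  assumes "0 < r"
  shows "measure_pmf.prob (poisson_pmf r) {2..} \<le> r\<^sup>2"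
proof -
  have "measure_pmf.prob (poisson_pmf r) {2..} = 1 - measure_pmf.prob (poisson_pmf r) {0, 1}"
    by (subst measure_pmf.prob_compl[symmetric]) (auto intro!: arg_cong[where f="measure _"])
  also have "measure_pmf.prob (poisson_pmf r) {0, 1} = (1 + r) * exp (- r)"
    using assms by (subst measure_measure_pmf_finite) (auto simp: algebra_simps)
  also have "1 - (1 + r) * exp (- r) \<le> 1 - (1 + r) * (1 - r)"
    using exp_ge_add_one_self[of "- r"] assms by (intro diff_left_mono mult_left_mono) auto
  finally show ?thesis by (simp add: algebra_simps power2_eq_square)
qed

text \<open>If \<open>f\<close> is harmonic at the origin, the contributions of no jump and of one jump agree with
  \<open>f 0\<close>, so that only the event of at least two jumps matters.\<close>

lemma compound_poisson_harmonic_bound: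
  fixes Q :: "nat pmf" and f :: "int \<Rightarrow> real"
  assumes r: "0 < r" and f: "\<And>i. 0 \<le> f i" "\<And>i. f i \<le> 1"
    and harm: "(LINT d|Q. f (1 - int d)) = f 0"
  shows "\<bar>(LINT i|compound_poisson_pmf Q r. f i) - f 0\<bar> \<le> r\<^sup>2"
proof -
  note int = integrable_pmf_bounded[where 'c=real and B=1, simplified]
  have f1: "\<bar>f i\<bar> \<le> 1" for i using f[of i] by simp
  define a where "a n = (LINT i|jump_sum_pmf Q n. f i)" for n
  have a: "0 \<le> a n" "a n \<le> 1" for n
    unfolding a_def using int[OF f1] f by (auto intro!: measure_pmf.integral_le_const)
  have a0: "a 0 = f 0" by (simp add: a_def)
  have "a 1 = (LINT d|Q. LINT s|return_pmf 0. f (1 - int d + s))"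
    unfolding a_def by (simp, subst integral_bind_pmf_bounded_real[where B=1]) (use f1 in auto)
  then have a1: "a 1 = f 0" using harm by simp
  have b: "\<bar>a n - f 0\<bar> \<le> indicator {2..} n" for n
  proof -
    consider "n = 0" | "n = 1" | "2 \<le> n" by linarith
    then show ?thesis
      using a[of n] f[of 0] a0 a1 by cases auto
  qed
  have "(LINT i|compound_poisson_pmf Q r. f i) - f 0 = (LINT n|poisson_pmf r. a n) - f 0"
    unfolding compound_poisson_pmf_def a_def by (subst integral_bind_pmf_bounded_real[where B=1]) (use f1 in auto)
  also have "\<dots> = (LINT n|poisson_pmf r. a n - f 0)"
    by (subst Bochner_Integration.integral_diff) (use int[of a] a in auto)
  finally have "\<bar>(LINT i|compound_poisson_pmf Q r. f i) - f 0\<bar> \<le> (LINT n|poisson_pmf r. \<bar>a n - f 0\<bar>)"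
    using integral_abs_bound by metis
  also have "\<dots> \<le> (LINT n|poisson_pmf r. indicator {2..} n)"
    using b by (intro integral_mono int) (auto intro: order.trans[OF b] split: split_indicator)
  also have "\<dots> \<le> r\<^sup>2" using poisson_two_or_more[OF r] by simp
  finally show ?thesis .
qed

text \<open>With positive probability there are exactly \<open>nat N\<close> jumps and all of them
  go upwards, that is, have \<open>d = 0\<close>.\<close>

lemma compound_poisson_pmf_unbounded:
  assumes "0 < r" "0 < pmf Q 0"
  shows "0 < measure_pmf.prob (compound_poisson_pmf Q r) {N..}"
proof -
  have "int n \<in> set_pmf (jump_sum_pmf Q n)" for n
  proof (induction n)
    case (Suc n)
    have "0 \<in> set_pmf Q" using assms(2) by (simp add: set_pmf_iff)
    then show ?case using Suc by (auto intro!: bexI[of _ 0])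
  qed simp
  then have "int (nat N) \<in> set_pmf (compound_poisson_pmf Q r)"
    unfolding compound_poisson_pmf_def set_bind_pmf set_pmf_poisson[OF assms(1)] by blast
  moreover have "int (nat N) \<in> {N..}" by simp
  ultimately have "{N..} \<inter> set_pmf (compound_poisson_pmf Q r) \<noteq> {}" by blast
  then show ?thesis
    by (simp add: measure_pmf_zero_iff zero_less_measure_iff Int_commute)
qed

section \<open>The jump law obtained from the Levy measure\<close>

text \<open>Each point outside the support lies in a basic open null set, and a countable basis
  provides only countably many of these.\<close>

lemma AE_in_measure_support:
  fixes \<mu> :: "'b::second_countable_topology measure"
  assumes "\<And>U. open U \<Longrightarrow> U \<inter> space \<mu> \<in> sets \<mu>"
  shows "AE x in \<mu>. x \<in> measure_support \<mu>"
proof -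
  obtain B :: "'b set set" where B: "countable B" "topological_basis B"
    using ex_countable_basis by auto
  let ?N = "\<Union>b\<in>{b\<in>B. emeasure \<mu> (b \<inter> space \<mu>) = 0}. b \<inter> space \<mu>"
  have "?N \<in> null_sets \<mu>"
    using B assms by (intro null_sets_UN') (auto simp: topological_basis_open intro!: null_setsI)
  moreover have "x \<in> ?N" if x: "x \<in> space \<mu>" "x \<notin> measure_support \<mu>" for x
  proof -
    from x obtain U where U: "open U" "x \<in> U" "emeasure \<mu> (U \<inter> space \<mu>) = 0"
      unfolding measure_support_def by (auto simp: zero_less_iff_neq_zero)
    then obtain b where b: "b \<in> B" "x \<in> b" "b \<subseteq> U"
      using topological_basisE[OF B(2)] by metis
    then have "emeasure \<mu> (b \<inter> space \<mu>) \<le> emeasure \<mu> (U \<inter> space \<mu>)"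
      using assms[OF U(1)] by (intro emeasure_mono) auto
    with U b x show ?thesis by auto
  qed
  ultimately show ?thesis by (intro AE_I'[of ?N]) auto
qed

context upwards_skip_free_levy_chain
begin

definition rate :: real where "rate = measure lam UNIV"

text \<open>The law of the variable \<open>D\<close>: its mass at \<open>m\<close> is the
  probability that a jump equals \<open>h * (1 - real m)\<close>, with \<open>m = 0\<close> for the
  jump up. That the weights sum to one is part of the proof of \<open>pmf_down_pmf\<close>.\<close>

definition down_pmf :: "nat pmf" where
  "down_pmf = embed_pmf (\<lambda>m. measure lam {h * (1 - real m)} / rate)"

lemma space_lam: "space lam = UNIV"
  using sets_eq_imp_space_eq[OF sets_lam] by simp

text \<open>By the two support assumptions almost every jump is a lattice point \<open>h * k\<close>
  and is \<open>h\<close> if positive; hence \<open>k \<le> 1\<close>, and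
  \<open>m = nat (1 - k)\<close> works.\<close>

lemma AE_lam_step: "AE x in lam. \<exists>m. x = h * (1 - real m)"
proof -
  have "AE x in lam. x \<in> measure_support lam"
    by (rule AE_in_measure_support) (simp add: space_lam sets_lam)
  moreover have "AE x in restrict_space lam {0<..}. x \<in> {h}"
    unfolding lam_upward[symmetric]
  proof (rule AE_in_measure_support)
    fix U :: "real set" assume "open U"
    then have "{0<..} \<inter> U \<in> sets (restrict_space lam {0<..})"
      unfolding sets_restrict_space sets_lam by (intro imageI) simp
    then show "U \<inter> space (restrict_space lam {0<..}) \<in> sets (restrict_space lam {0<..})"
      by (simp add: space_restrict_space space_lam Int_commute)
  qed
  then have "AE x in lam. 0 < x \<longrightarrow> x = h"
    by (subst (asm) AE_restrict_space_iff) (auto simp: space_lam sets_lam)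
  ultimately show ?thesis
  proof eventually_elim
    case (elim x)
    then obtain k where k: "x = h * of_int k" using lam_lattice by (auto simp: lattice_def)
    have "k \<le> 1"
    proof (rule ccontr)
      assume k1: "\<not> k \<le> 1"
      then have "0 < x" unfolding k using h_pos by (intro mult_pos_pos) auto
      then have "h * of_int k = h" using elim(2) unfolding k by blast
      then have "real_of_int k = 1" using h_pos by (metis mult_cancel_left1 less_irrefl)
      then show False using k1 by simp
    qed
    then have "x = h * (1 - real (nat (1 - k)))" using k by simp
    then show ?case ..
  qed
qed

text \<open>As \<open>h\<close> lies in the support of the restriction, the positive half-line has
  positive mass, and \<open>AE_lam_step\<close> places all of it at \<open>h\<close>.\<close>

lemma lam_h_pos: "0 < measure lam {h}"
proof -
  interpret lam: finite_measure lam by (rule finite_lam)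
  have "h \<in> measure_support (restrict_space lam {0<..})" using lam_upward by simp
  then have "0 < emeasure (restrict_space lam {0<..}) (UNIV \<inter> {0<..})"
    unfolding measure_support_def space_restrict_space space_lam by auto
  also have "\<dots> = emeasure lam {0<..}"
    by (subst emeasure_restrict_space) (auto simp: space_lam sets_lam)
  also have "\<dots> = emeasure lam {h}"
  proof (rule emeasure_eq_AE)
    show "AE x in lam. (x \<in> {0<..}) = (x \<in> {h})"
      using AE_lam_step
    proof eventually_elim
      case (elim x)
      then obtain m where m: "x = h * (1 - real m)" ..
      show ?case
      proof (cases "m = 0")
        case False
        then have "x \<le> 0" unfolding m using h_pos by (intro mult_nonneg_nonpos) auto
        then show ?thesis using h_pos by auto
      qed (use m h_pos in simp)
    qed
  qed (auto simp: sets_lam)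
  finally show ?thesis by (simp add: lam.emeasure_eq_measure)
qed

lemma rate_pos: "0 < rate"
proof -
  interpret lam: finite_measure lam by (rule finite_lam)
  show ?thesis
    using lam_h_pos lam.finite_measure_mono[of "{h}" UNIV] by (simp add: rate_def sets_lam)
qed

lemma emeasure_lam_steps:
  assumes "A \<in> sets borel"
  shows "emeasure lam A = (\<integral>\<^sup>+m. emeasure lam {h * (1 - real m)} * indicator A (h * (1 - real m)) \<partial>count_space UNIV)"
proof -
  let ?c = "\<lambda>m. h * (1 - real m)"
  have "emeasure lam A = emeasure lam (\<Union>m. A \<inter> {?c m})"
    using AE_lam_step assms by (intro emeasure_eq_AE) (auto simp: sets_lam elim!: eventually_mono)
  also have "\<dots> = (\<integral>\<^sup>+m. emeasure lam (A \<inter> {?c m}) \<partial>count_space UNIV)"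
    using assms h_pos by (intro emeasure_UN_countable) (auto simp: sets_lam disjoint_family_on_def)
  also have "\<dots> = (\<integral>\<^sup>+m. emeasure lam {?c m} * indicator A (?c m) \<partial>count_space UNIV)"
    by (intro nn_integral_cong) (auto split: split_indicator)
  finally show ?thesis .
qed

lemma pmf_down_pmf: "pmf down_pmf m = measure lam {h * (1 - real m)} / rate"
proof -
  interpret lam: finite_measure lam by (rule finite_lam)
  have "(\<integral>\<^sup>+m. ennreal (measure lam {h * (1 - real m)} / rate) \<partial>count_space UNIV) =
      (\<integral>\<^sup>+m. emeasure lam {h * (1 - real m)} / ennreal rate \<partial>count_space UNIV)"
    using rate_pos by (intro nn_integral_cong) (simp add: lam.emeasure_eq_measure divide_ennreal)
  also have "\<dots> = emeasure lam UNIV / ennreal rate"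
    by (subst nn_integral_divide) (auto simp: emeasure_lam_steps[of UNIV])
  also have "\<dots> = 1"
    using rate_pos by (simp add: lam.emeasure_eq_measure divide_ennreal rate_def)
  finally show ?thesis
    unfolding down_pmf_def using rate_pos by (intro pmf_embed_pmf) auto
qed

lemma down_pmf_0: "0 < pmf down_pmf 0"
  using lam_h_pos rate_pos by (simp add: pmf_down_pmf)

lemma lam_eq_density:
  "lam = density (distr down_pmf borel (\<lambda>m. h * (1 - real m))) (\<lambda>_. ennreal rate)"
proof (rule measure_eqI)
  interpret lam: finite_measure lam by (rule finite_lam)
  fix A assume "A \<in> sets lam"
  then have A: "A \<in> sets borel" by (simp add: sets_lam)
  have "emeasure lam A = (\<integral>\<^sup>+m. ennreal rate * (ennreal (pmf down_pmf m) * indicator A (h * (1 - real m))) \<partial>count_space UNIV)"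
    unfolding emeasure_lam_steps[OF A] using rate_pos
    by (intro nn_integral_cong)
       (auto simp: pmf_down_pmf lam.emeasure_eq_measure ennreal_mult[symmetric] split: split_indicator)
  also have "\<dots> = ennreal rate * (\<integral>\<^sup>+m. indicator A (h * (1 - real m)) \<partial>down_pmf)"
    by (subst nn_integral_cmult) (auto simp: nn_integral_measure_pmf)
  also have "(\<integral>\<^sup>+m. indicator A (h * (1 - real m)) \<partial>down_pmf) =
      emeasure down_pmf ((\<lambda>m. h * (1 - real m)) -` A)"
  proof -
    have "(\<integral>\<^sup>+m. indicator A (h * (1 - real m)) \<partial>down_pmf) =
        (\<integral>\<^sup>+m. indicator ((\<lambda>m. h * (1 - real m)) -` A) m \<partial>down_pmf)"
      by (intro nn_integral_cong) (simp split: split_indicator)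
    also have "\<dots> = emeasure down_pmf ((\<lambda>m. h * (1 - real m)) -` A)"
      by (rule nn_integral_indicator) simp
    finally show ?thesis .
  qed
  also have "ennreal rate * emeasure down_pmf ((\<lambda>m. h * (1 - real m)) -` A) = emeasure (density (distr down_pmf borel (\<lambda>m. h * (1 - real m))) (\<lambda>_. ennreal rate)) A"
    using A by (simp add: emeasure_density_const emeasure_distr)
  finally show "emeasure lam A = \<dots>" .
qed (simp add: sets_lam)

lemma integral_lam:
  fixes g :: "real \<Rightarrow> 'b::{banach, second_countable_topology}"
  assumes [measurable]: "g \<in> borel_measurable borel"
  shows "(LINT x|lam. g x) = rate *\<^sub>R (LINT m|down_pmf. g (h * (1 - real m)))"
proof -
  have "(LINT x|lam. g x) = (LINT x|distr down_pmf borel (\<lambda>m. h * (1 - real m)). rate *\<^sub>R g x)"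
    using rate_pos by (subst lam_eq_density, subst integral_density) auto
  also have "\<dots> = rate *\<^sub>R (LINT m|down_pmf. g (h * (1 - real m)))"
    by (simp add: integral_distr)
  finally show ?thesis .
qed

text \<open>By \<open>integral_lam\<close> the exponent in \<open>char_X\<close> is
  \<open>rate * t\<close> times the characteristic function of a jump minus one, which is the
  compound Poisson exponent.\<close>

lemma distr_X:
  assumes t: "0 < t"
  shows "distr M borel (X t) = distr (compound_poisson_pmf down_pmf (rate * t)) borel (\<lambda>i. h * of_int i)"
proof (rule Levy_uniqueness)
  have Xm: "X t \<in> borel_measurable M"
    using X_adapted[of t] subalgebra_F[of t] t by (metis less_imp_le measurable_from_subalg)
  show "real_distribution (distr M borel (X t))"
    using Xm by (rule real_distribution_distr)
  show "real_distribution (distr (compound_poisson_pmf down_pmf (rate * t)) borel (\<lambda>i. h * of_int i))"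
    by (rule prob_space.real_distribution_distr[OF measure_pmf.prob_space_axioms]) simp
  show "char (distr M borel (X t)) = char (distr (compound_poisson_pmf down_pmf (rate * t)) borel (\<lambda>i. h * of_int i))"
  proof
    fix p
    have i: "integrable (measure_pmf down_pmf) (\<lambda>d. iexp (p * (h * (1 - real d))))"
      by (intro measure_pmf.integrable_const_bound[where B=1]) auto
    have "char (distr M borel (X t)) p = exp (of_real t * (CLINT x|lam. iexp (p * x) - 1))"
      using t by (intro char_X) simp
    also have "(CLINT x|lam. iexp (p * x) - 1) =
        rate *\<^sub>R (LINT m|down_pmf. iexp (p * (h * (1 - real m))) - 1)"
      by (rule integral_lam) simp
    also have "(LINT m|down_pmf. iexp (p * (h * (1 - real m))) - 1) =
        (LINT m|down_pmf. iexp (p * (h * (1 - real m)))) - 1"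
      by (subst Bochner_Integration.integral_diff[OF i]) auto
    finally show "char (distr M borel (X t)) p =
        char (distr (compound_poisson_pmf down_pmf (rate * t)) borel (\<lambda>i. h * of_int i)) p"
      using t rate_pos by (subst char_compound_poisson_pmf) (auto simp: scaleR_conv_of_real mult_ac)
  qed
qed

end

section \<open>The scale sequence and its generating function\<close>

text \<open>The scale function on the lattice, obtained by solving for the last term the equation which
  says that it is harmonic for the chain killed on becoming negative.\<close>

fun scale_seq :: "nat pmf \<Rightarrow> nat \<Rightarrow> real" where
  "scale_seq Q 0 = 1"
| "scale_seq Q (Suc n) = (scale_seq Q n - (\<Sum>k\<le>n. pmf Q (Suc n - k) * scale_seq Q k)) / pmf Q 0"

text \<open>The recursion cleared of its division: the summand \<open>k = Suc n\<close> carries the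
  factor \<open>pmf Q 0\<close>. With \<open>d = Suc n - k\<close> this is the harmonicity
  equation.\<close>

lemma scale_seq_convolution:
  assumes "0 < pmf Q 0"
  shows "(\<Sum>k\<le>Suc n. pmf Q (Suc n - k) * scale_seq Q k) = scale_seq Q n"
  using assms by simp

lemma sum_pmf_le_1: "finite A \<Longrightarrow> sum (pmf Q) A \<le> 1"
  using measure_measure_pmf_finite[of A Q] measure_pmf.prob_le_1[of Q A] by simp

text \<open>The weights in the recursion have total at most \<open>1 - pmf Q 0\<close>, so at least
  the fraction \<open>pmf Q 0\<close> of the previous term survives the subtraction. Bounding the
  sum needs positivity and monotonicity together.\<close>

lemma scale_seq_pos_mono_aux:
  assumes s: "0 < pmf Q 0"
  shows "\<forall>k\<le>n. 0 < scale_seq Q k \<and> scale_seq Q k \<le> scale_seq Q n"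
proof (induction n)
  case (Suc n)
  let ?w = "scale_seq Q"
  have "(\<Sum>k\<le>n. pmf Q (Suc n - k) * ?w k) \<le> (\<Sum>k\<le>n. pmf Q (Suc n - k) * ?w n)"
    using Suc by (intro sum_mono mult_left_mono) auto
  also have "\<dots> = sum (pmf Q) ((\<lambda>k. Suc n - k) ` {..n}) * ?w n"
    by (subst sum.reindex) (auto simp: sum_distrib_right inj_on_def)
  also have "\<dots> \<le> (1 - pmf Q 0) * ?w n"
  proof (intro mult_right_mono)
    have "pmf Q 0 + sum (pmf Q) ((\<lambda>k. Suc n - k) ` {..n}) =
        sum (pmf Q) (insert 0 ((\<lambda>k. Suc n - k) ` {..n}))"
      by (subst sum.insert) auto
    also have "\<dots> \<le> 1" by (rule sum_pmf_le_1) simp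
    finally show "sum (pmf Q) ((\<lambda>k. Suc n - k) ` {..n}) \<le> 1 - pmf Q 0" by simp
  qed (use Suc in \<open>auto intro: less_imp_le\<close>)
  finally have "?w n \<le> ?w (Suc n)"
    using s by (simp add: field_simps)
  then show ?case using Suc by (auto simp: le_Suc_eq simp del: scale_seq.simps(2) intro: order.trans less_le_trans)
qed simp

section \<open>Exit probabilities and the generating function\<close>

text \<open>The candidate for the probability of reaching \<open>K\<close> from \<open>i\<close>
  before becoming negative. It is one on all of \<open>[K, \<infinity>)\<close>, since a path
  sampled on a time grid can overshoot \<open>K\<close>.\<close>

definition exit_prob :: "nat pmf \<Rightarrow> nat \<Rightarrow> int \<Rightarrow> real" where
  "exit_prob Q K i = (if i < 0 then 0 else if int K \<le> i then 1 else scale_seq Q (nat i) / scale_seq Q K)"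

definition pgf :: "nat pmf \<Rightarrow> real \<Rightarrow> real" where
  "pgf Q z = (LINT d|Q. z ^ d)"

lemma pgf_sums:
  assumes "\<bar>z\<bar> \<le> 1"
  shows "(\<lambda>n. pmf Q n * z ^ n) sums pgf Q z"
  using expectation_nat_pmf_sums[of "\<lambda>n. z ^ n" 1 Q] assms
  by (simp add: pgf_def power_abs power_le_one)

lemma continuous_on_pgf: "continuous_on {-1..1} (pgf Q)"
  unfolding pgf_def
  by (rule continuous_on_LINT_pmf[where B=1])
     (auto intro!: continuous_intros simp: power_abs power_le_one)

context
  fixes Q :: "nat pmf"
  assumes Q0: "0 < pmf Q 0"
begin

lemma scale_seq_pos: "0 < scale_seq Q n"
  using scale_seq_pos_mono_aux[OF Q0] by blast

lemma scale_seq_mono: "m \<le> n \<Longrightarrow> scale_seq Q m \<le> scale_seq Q n"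
  using scale_seq_pos_mono_aux[OF Q0] by blast

text \<open>Dropping the subtracted nonnegative sum leaves geometric growth; this yields the
  exponential order of \<open>W\<close>.\<close>

lemma scale_seq_le: "scale_seq Q n \<le> (1 / pmf Q 0) ^ n"
proof (induction n)
  case (Suc n)
  have "0 \<le> (\<Sum>k\<le>n. pmf Q (Suc n - k) * scale_seq Q k)"
    using scale_seq_pos by (intro sum_nonneg mult_nonneg_nonneg) (auto intro: less_imp_le)
  then have "scale_seq Q (Suc n) \<le> scale_seq Q n / pmf Q 0"
    using Q0 by (simp add: divide_right_mono)
  also have "\<dots> \<le> (1 / pmf Q 0) ^ Suc n"
    using Suc Q0 by (simp add: field_simps)
  finally show ?case .
qed simp

lemma exit_prob_bounds: "0 \<le> exit_prob Q K i" "exit_prob Q K i \<le> 1"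
  using scale_seq_pos scale_seq_mono[of "nat i" K]
  by (auto simp: exit_prob_def intro: less_imp_le)

text \<open>One jump leads at most to \<open>i + 1 \<le> K\<close>, so every nonnegative target has
  the quotient form, and \<open>scale_seq_convolution\<close> applies.\<close>

lemma exit_prob_harmonic:
  assumes i: "0 \<le> i" "i < int K"
  shows "(LINT d|Q. exit_prob Q K (i + (1 - int d))) = exit_prob Q K i"
proof -
  let ?n = "nat i"
  have e: "exit_prob Q K (int m) = scale_seq Q m / scale_seq Q K" if "m \<le> K" for m
    using that scale_seq_pos[of K] by (auto simp: exit_prob_def)
  \<comment> \<open>For \<open>d > i + 1\<close> the target is negative and the value zero, which
    makes the sum finite.\<close>
  have "(LINT d|Q. exit_prob Q K (i + (1 - int d))) = (\<Sum>d\<in>{..<Suc (Suc ?n)}. exit_prob Q K (i + (1 - int d)) * pmf Q d)"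
    using i by (intro integral_measure_pmf_real) (auto simp: exit_prob_def split: if_splits)
  also have "\<dots> = (\<Sum>d<Suc (Suc ?n). scale_seq Q (Suc ?n - d) / scale_seq Q K * pmf Q d)"
  proof (intro sum.cong refl arg_cong2[where f="(*)"])
    fix d assume "d \<in> {..<Suc (Suc ?n)}"
    then have d: "i + (1 - int d) = int (Suc ?n - d)" "Suc ?n - d \<le> K" using i by auto
    show "exit_prob Q K (i + (1 - int d)) = scale_seq Q (Suc ?n - d) / scale_seq Q K"
      unfolding d(1) by (rule e[OF d(2)])
  qed
  also have "\<dots> = (\<Sum>k<Suc (Suc ?n). pmf Q (Suc ?n - k) * scale_seq Q k) / scale_seq Q K"
    unfolding sum_divide_distrib
    by (subst sum.nat_diff_reindex[symmetric], intro sum.cong refl) (simp add: mult.commute del: scale_seq.simps)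
  also have "\<dots> = exit_prob Q K i"
    unfolding lessThan_Suc_atMost scale_seq_convolution[OF Q0] using i by (simp add: exit_prob_def)
  finally show ?thesis .
qed

lemma pgf_ge: "0 \<le> z \<Longrightarrow> z \<le> 1 \<Longrightarrow> pmf Q 0 \<le> pgf Q z"
  using pgf_sums[of z] sum_le_suminf[of "\<lambda>n. pmf Q n * z ^ n" "{0}"]
  by (auto simp: sums_iff)

text \<open>In the Cauchy product of the two power series the coefficient of order zero is
  \<open>pmf Q 0\<close>, and by \<open>scale_seq_convolution\<close> the one of order
  \<open>Suc k\<close> is \<open>scale_seq Q k\<close>.\<close>

lemma scale_seq_generating_function:
  assumes z: "0 \<le> z" "z \<le> 1" and sm: "summable (\<lambda>n. scale_seq Q n * z ^ n)"
  shows "(\<Sum>n. scale_seq Q n * z ^ n) * (pgf Q z - z) = pmf Q 0"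
proof -
  let ?a = "\<lambda>n. scale_seq Q n * z ^ n" and ?b = "\<lambda>n. pmf Q n * z ^ n"
  have b: "?b sums pgf Q z" using z by (intro pgf_sums) auto
  have sa: "summable (\<lambda>n. norm (?a n))"
    using sm z scale_seq_pos by (simp add: abs_mult less_imp_le)
  have sb: "summable (\<lambda>n. norm (?b n))"
    using sums_summable[OF b] z by (simp add: abs_mult)
  have "(\<lambda>k. \<Sum>i\<le>k. ?a i * ?b (k - i)) sums ((\<Sum>n. ?a n) * (\<Sum>n. ?b n))"
    by (rule Cauchy_product_sums[OF sa sb])
  moreover have "(\<Sum>i\<le>k. ?a i * ?b (k - i)) = (\<Sum>i\<le>k. pmf Q (k - i) * scale_seq Q i) * z ^ k" for k
    unfolding sum_distrib_right
  proof (intro sum.cong refl)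
    fix i assume "i \<in> {..k}"
    then have "z ^ k = z ^ i * z ^ (k - i)" by (simp flip: power_add)
    then show "?a i * ?b (k - i) = pmf Q (k - i) * scale_seq Q i * z ^ k" by simp
  qed
  ultimately have "(\<lambda>k. (\<Sum>i\<le>k. pmf Q (k - i) * scale_seq Q i) * z ^ k) sums ((\<Sum>n. ?a n) * pgf Q z)"
    using b by (simp add: sums_iff)
  then have "(\<lambda>k. (\<Sum>i\<le>Suc k. pmf Q (Suc k - i) * scale_seq Q i) * z ^ Suc k) sums ((\<Sum>n. ?a n) * pgf Q z - pmf Q 0)"
    by (subst sums_Suc_iff) simp
  then have "(\<lambda>k. z * ?a k) sums ((\<Sum>n. ?a n) * pgf Q z - pmf Q 0)"
    unfolding scale_seq_convolution[OF Q0] by (simp add: mult_ac)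
  moreover have "(\<lambda>k. z * ?a k) sums (z * (\<Sum>n. ?a n))"
    using sm by (intro sums_mult) (simp add: summable_sums)
  ultimately have "(\<Sum>n. ?a n) * pgf Q z - pmf Q 0 = z * (\<Sum>n. ?a n)"
    by (rule sums_unique2)
  then show ?thesis by (simp add: algebra_simps)
qed

text \<open>Monotonicity of the ratios makes the power series diverge at its radius of convergence \<open>R\<close>,
  whereas the generating function stays bounded up to any point at which \<open>pgf Q z - z\<close> does not
  vanish.\<close>

lemma summable_scale_seq:
  assumes mono: "incseq (\<lambda>n. scale_seq Q n / scale_seq Q (Suc n))"
    and pos: "\<And>z. 0 < z \<Longrightarrow> z < z0 \<Longrightarrow> z < pgf Q z" and z0: "z0 \<le> 1"
    and z: "0 < z" "z < z0"
  shows "summable (\<lambda>n. scale_seq Q n * z ^ n)"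
proof -
  note [simp del] = scale_seq.simps(2)
  let ?r = "\<lambda>n. scale_seq Q n / scale_seq Q (Suc n)"
  have "?r n \<le> 1" for n
    using scale_seq_pos[of "Suc n"] scale_seq_mono[of n "Suc n"] by simp
  \<comment> \<open>The limit of the increasing ratios is the radius of convergence.\<close>
  then obtain R where R: "?r \<longlonglongrightarrow> R" "\<And>n. ?r n \<le> R"
    using incseq_convergent[OF mono, of 1] by auto
  have r_pos: "0 < ?r n" for n using scale_seq_pos by simp
  have R_pos: "0 < R" using r_pos[of 0] R(2)[of 0] by linarith
  have below: "summable (\<lambda>n. scale_seq Q n * u ^ n)" if u: "0 < u" "u < R" for u
  proof -
    obtain N where N: "u < ?r N"
      using order_tendstoD(1)[OF R(1) u(2)] by (auto simp: eventually_sequentially)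
    show ?thesis
    proof (rule summable_ratio_test)
      show "u / ?r N < 1" using N divide_less_eq_1_pos[OF r_pos] by blast
      fix n assume "N \<le> n"
      then have "?r N \<le> ?r n" using mono by (auto simp: incseq_def)
      then have "u / ?r n \<le> u / ?r N"
        by (rule divide_left_mono[OF _ less_imp_le[OF u(1)] mult_pos_pos[OF r_pos r_pos]])
      then have "scale_seq Q n * u ^ n * (u / ?r n) \<le> scale_seq Q n * u ^ n * (u / ?r N)"
        using u scale_seq_pos[of n] by (intro mult_left_mono) auto
      then show "norm (scale_seq Q (Suc n) * u ^ Suc n) \<le> u / ?r N * norm (scale_seq Q n * u ^ n)"
        using u scale_seq_pos[of n] scale_seq_pos[of "Suc n"] by (simp add: abs_mult mult_ac)
    qed
  qed
  show ?thesis
  proof (cases "z < R")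
    case True
    with z show ?thesis by (intro below) auto
  next
    case False
    then have Rz: "R < z0" using z by simp
    \<comment> \<open>Every ratio is at most \<open>R\<close>, so the terms at \<open>R\<close> do
      not decrease from their initial value one and the partial sums there are unbounded.\<close>
    have ge1: "1 \<le> scale_seq Q n * R ^ n" for n
    proof (induction n)
      case (Suc n)
      have "1 \<le> R / ?r n" using R(2)[of n] le_divide_eq_1_pos[OF r_pos] by blast
      then have "1 * 1 \<le> (scale_seq Q n * R ^ n) * (R / ?r n)"
        by (rule mult_mono[OF Suc]) (use Suc in simp_all)
      then show ?case using scale_seq_pos[of n] by (simp add: mult_ac)
    qed simp
    \<comment> \<open>The generating function identity bounds the partial sums at
      \<open>u < R\<close>; the bound passes to \<open>R\<close> because \<open>pgf Q R - R\<close>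
      is positive for \<open>R < z0\<close>.\<close>
    have partial: "(\<Sum>n<K. scale_seq Q n * R ^ n) \<le> pmf Q 0 / (pgf Q R - R)" for K
    proof (rule tendsto_le)
      have "isCont (pgf Q) R"
        using continuous_on_interior[OF continuous_on_pgf, of R] R_pos Rz z0 by simp
      then have "((\<lambda>u. pmf Q 0 / (pgf Q u - u)) \<longlongrightarrow> pmf Q 0 / (pgf Q R - R)) (at R)"
        using pos[OF R_pos Rz] by (intro tendsto_intros) (auto simp: isCont_def)
      then show "((\<lambda>u. pmf Q 0 / (pgf Q u - u)) \<longlongrightarrow> pmf Q 0 / (pgf Q R - R)) (at_left R)"
        by (rule tendsto_mono[rotated]) (simp add: at_le)
      show "((\<lambda>u. \<Sum>n<K. scale_seq Q n * u ^ n) \<longlongrightarrow> (\<Sum>n<K. scale_seq Q n * R ^ n)) (at_left R)"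
        by (intro tendsto_intros)
      have "eventually (\<lambda>u. u \<in> {0<..<R}) (at_left R)"
        using R_pos by (intro eventually_at_leftI[of 0]) auto
      then show "\<forall>\<^sub>F u in at_left R. (\<Sum>n<K. scale_seq Q n * u ^ n) \<le> pmf Q 0 / (pgf Q u - u)"
      proof eventually_elim
        case (elim u)
        then have s: "summable (\<lambda>n. scale_seq Q n * u ^ n)" by (intro below) auto
        have p: "u < pgf Q u" using elim Rz by (intro pos) auto
        have "(\<Sum>n<K. scale_seq Q n * u ^ n) \<le> (\<Sum>n. scale_seq Q n * u ^ n)"
          using elim scale_seq_pos by (intro sum_le_suminf[OF s]) (auto intro: less_imp_le)
        also have "\<dots> = pmf Q 0 / (pgf Q u - u)"
          using scale_seq_generating_function[OF _ _ s] elim Rz z0 p by (simp add: field_simps)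
        finally show ?case .
      qed
    qed simp
    have "real K \<le> pmf Q 0 / (pgf Q R - R)" for K
      using sum_mono[of "{..<K}" "\<lambda>_. 1" "\<lambda>n. scale_seq Q n * R ^ n"] ge1 partial[of K] by simp
    then show ?thesis using reals_Archimedean2[of "pmf Q 0 / (pgf Q R - R)"] by (meson not_le)
  qed
qed

end

section \<open>Laplace transforms of step functions\<close>

lemma has_bochner_integral_exp_interval:
  fixes a b \<beta> :: real
  assumes "a \<le> b" "\<beta> \<noteq> 0"
  shows "has_bochner_integral lborel (\<lambda>x. exp (- \<beta> * x) * indicator {a..<b} x) ((exp (- \<beta> * a) - exp (- \<beta> * b)) / \<beta>)"
proof -
  have "has_bochner_integral lborel (\<lambda>x. exp (- \<beta> * x) * indicator {a..b} x)
      (- exp (- \<beta> * b) / \<beta> - (- exp (- \<beta> * a) / \<beta>))"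
    using assms
    by (intro has_bochner_integral_FTC_Icc_real)
       (auto intro!: derivative_eq_intros continuous_intros)
  moreover have "AE x in lborel. exp (- \<beta> * x) * indicator {a..b} x = exp (- \<beta> * x) * indicator {a..<b} x"
    using AE_lborel_singleton[of b] by eventually_elim (auto split: split_indicator)
  ultimately have "has_bochner_integral lborel (\<lambda>x. exp (- \<beta> * x) * indicator {a..<b} x)
      (- exp (- \<beta> * b) / \<beta> - (- exp (- \<beta> * a) / \<beta>))"
    by (subst (asm) has_bochner_integral_cong_AE) auto
  then show ?thesis using assms(2) by (simp add: diff_divide_distrib)
qed

text \<open>The half-line splits into cells of length \<open>h\<close> on which the function is
  constant; nonnegativity and summability justify integration term by term.\<close>

lemma has_laplace_transform_step:
  fixes w :: "nat \<Rightarrow> real"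
  assumes h: "0 < h" and \<beta>: "0 < \<beta>" and w: "\<And>n. 0 \<le> w n"
    and sm: "summable (\<lambda>n. w n * exp (- \<beta> * h) ^ n)"
  shows "has_laplace_transform (\<lambda>x. w (nat \<lfloor>x / h\<rfloor>)) \<beta>
    ((1 - exp (- \<beta> * h)) / \<beta> * (\<Sum>n. w n * exp (- \<beta> * h) ^ n))"
proof -
  let ?I = "\<lambda>n. {h * real n..<h * real (Suc n)}"
  let ?f = "\<lambda>n x. w n * (exp (- \<beta> * x) * indicator (?I n) x)"
  let ?c = "(1 - exp (- \<beta> * h)) / \<beta>"
  have hb: "has_bochner_integral lborel (?f n) (?c * (w n * exp (- \<beta> * h) ^ n))" for n
  proof -
    have "has_bochner_integral lborel (?f n) (w n * ((exp (- \<beta> * (h * real n)) - exp (- \<beta> * (h * real (Suc n)))) / \<beta>))"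
      using h \<beta> by (intro has_bochner_integral_mult_right has_bochner_integral_exp_interval) auto
    also have "exp (- \<beta> * (h * real n)) - exp (- \<beta> * (h * real (Suc n))) = (1 - exp (- \<beta> * h)) * exp (- \<beta> * h) ^ n"
      by (simp add: exp_of_nat_mult[symmetric] mult_exp_exp algebra_simps)
    finally show ?thesis by (simp add: mult_ac)
  qed
  have mem: "x \<in> ?I n \<longleftrightarrow> n = nat \<lfloor>x / h\<rfloor>" if "0 \<le> x" for x n
  proof -
    have "x \<in> ?I n \<longleftrightarrow> real n \<le> x / h \<and> x / h < real n + 1"
      using h by (simp add: field_simps)
    also have "\<dots> \<longleftrightarrow> \<lfloor>x / h\<rfloor> = int n" by (simp add: floor_eq_iff)
    also have "\<dots> \<longleftrightarrow> n = nat \<lfloor>x / h\<rfloor>" using that h by auto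
    finally show ?thesis .
  qed
  have fs: "(\<lambda>n. ?f n x) sums (indicator {0..} x * (exp (- \<beta> * x) * w (nat \<lfloor>x / h\<rfloor>)))" for x
  proof (cases "0 \<le> x")
    case True
    then have "(\<lambda>n. ?f n x) = (\<lambda>n. if n = nat \<lfloor>x / h\<rfloor> then exp (- \<beta> * x) * w n else 0)"
      using mem[OF True] by (auto simp: fun_eq_iff split: split_indicator)
    then show ?thesis using sums_single[of "nat \<lfloor>x / h\<rfloor>" "\<lambda>n. exp (- \<beta> * x) * w n"] True by simp
  next
    case False
    then have "x \<notin> ?I n" for n using h by (auto simp: not_le intro: less_le_trans)
    then show ?thesis using False by (simp add: sums_zero)
  qed
  have nf: "norm (?f n x) = ?f n x" for n x using w by (simp add: abs_mult)
  have hyps: "\<And>n. integrable lborel (?f n)" "AE x in lborel. summable (\<lambda>n. norm (?f n x))"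
      "summable (\<lambda>n. \<integral>x. norm (?f n x) \<partial>lborel)"
  proof -
    show "integrable lborel (?f n)" for n using hb[of n] by (rule integrable.intros)
    show "AE x in lborel. summable (\<lambda>n. norm (?f n x))"
      unfolding nf using fs by (auto simp: sums_iff)
    show "summable (\<lambda>n. \<integral>x. norm (?f n x) \<partial>lborel)"
      unfolding nf has_bochner_integral_integral_eq[OF hb] by (intro summable_mult sm)
  qed
  have eq: "(\<lambda>x. \<Sum>n. ?f n x) = (\<lambda>x. indicator {0..} x * (exp (- \<beta> * x) * w (nat \<lfloor>x / h\<rfloor>)))"
    using fs by (auto simp: sums_iff fun_eq_iff)
  have "integrable lborel (\<lambda>x. \<Sum>n. ?f n x)" by (rule integrable_suminf[OF hyps])
  moreover have "(\<lambda>n. ?c * (w n * exp (- \<beta> * h) ^ n)) sums (\<integral>x. (\<Sum>n. ?f n x) \<partial>lborel)"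
    using sums_integral[OF hyps] unfolding has_bochner_integral_integral_eq[OF hb] .
  then have "(\<integral>x. (\<Sum>n. ?f n x) \<partial>lborel) = ?c * (\<Sum>n. w n * exp (- \<beta> * h) ^ n)"
    unfolding suminf_mult[OF sm, symmetric] by (rule sums_unique)
  ultimately show ?thesis
    unfolding eq has_laplace_transform_def set_integrable_def set_lebesgue_integral_def by simp
qed

section \<open>The Laplace exponent and its largest root\<close>

context upwards_skip_free_levy_chain
begin

text \<open>With \<open>z = exp (- \<beta> * h)\<close>, a jump \<open>h * (1 - m)\<close>
  contributes \<open>z ^ m * exp (\<beta> * h)\<close>.\<close>

lemma laplace_exponent_pgf:
  "laplace_exponent lam \<beta> = rate * (pgf down_pmf (exp (- \<beta> * h)) * exp (\<beta> * h) - 1)" if "0 \<le> \<beta>"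
proof -
  let ?z = "exp (- \<beta> * h)"
  have z: "0 \<le> ?z" "?z \<le> 1" using that h_pos by auto
  have i: "integrable (measure_pmf down_pmf) (\<lambda>m. ?z ^ m)"
    using z by (intro integrable_pmf_bounded[where B=1]) (simp add: power_le_one)
  have "laplace_exponent lam \<beta> = rate *\<^sub>R (LINT m|down_pmf. exp (\<beta> * (h * (1 - real m))) - 1)"
    unfolding laplace_exponent_def by (rule integral_lam) simp
  also have "(\<lambda>m. exp (\<beta> * (h * (1 - real m))) - 1) = (\<lambda>m. ?z ^ m * exp (\<beta> * h) - 1)"
    by (simp add: fun_eq_iff exp_of_nat_mult[symmetric] mult_exp_exp algebra_simps)
  also have "(LINT m|down_pmf. ?z ^ m * exp (\<beta> * h) - 1) = pgf down_pmf ?z * exp (\<beta> * h) - 1"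
    unfolding pgf_def using i by (subst Bochner_Integration.integral_diff) auto
  finally show ?thesis by simp
qed

text \<open>The zeros form a nonempty compact set, so the greatest one exists and is
  \<open>Phi0 lam\<close>. A nonpositive value beyond it would force a further zero, because the
  exponent is positive for all large arguments.\<close>

lemma above_Phi0:
  assumes \<beta>: "Phi0 lam < \<beta>"
  shows "0 < \<beta>" "0 < laplace_exponent lam \<beta>"
proof -
  let ?\<psi> = "laplace_exponent lam"
  have cont: "continuous_on {0..} ?\<psi>"
  proof (subst continuous_on_cong[OF refl laplace_exponent_pgf])
    show "continuous_on {0..} (\<lambda>\<beta>. rate * (pgf down_pmf (exp (- \<beta> * h)) * exp (\<beta> * h) - 1))"
      using h_pos
      by (intro continuous_intros continuous_on_compose2[OF continuous_on_pgf])
         (auto intro!: order.trans[of "-1" 0 "exp _"])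
  qed simp
  have large: "\<exists>B\<ge>a. \<forall>b\<ge>B. 0 < ?\<psi> b" for a
  proof (intro exI conjI allI impI)
    \<comment> \<open>The logarithm makes the contribution of the upward jump alone,
      \<open>pmf down_pmf 0 * exp (b * h)\<close>, at least two.\<close>
    let ?B = "max a (max 0 (ln (2 / pmf down_pmf 0) / h))"
    fix b assume "?B \<le> b"
    then have b: "0 \<le> b" "ln (2 / pmf down_pmf 0) \<le> b * h" using h_pos by (auto simp: field_simps)
    then have "exp (ln (2 / pmf down_pmf 0)) \<le> exp (b * h)" by simp
    then have "2 / pmf down_pmf 0 \<le> exp (b * h)"
      using down_pmf_0 by simp
    then have "2 \<le> pmf down_pmf 0 * exp (b * h)"
      using down_pmf_0 by (simp add: field_simps)
    also have "\<dots> \<le> pgf down_pmf (exp (- b * h)) * exp (b * h)"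
      using b h_pos by (intro mult_right_mono pgf_ge[OF down_pmf_0]) auto
    finally show "0 < ?\<psi> b" using b rate_pos by (subst laplace_exponent_pgf) auto
  qed simp
  define S where "S = {\<beta>. 0 \<le> \<beta> \<and> ?\<psi> \<beta> = 0}"
  have "closed ({0..} \<inter> ?\<psi> -` {0})"
    by (intro continuous_closed_preimage cont) auto
  moreover have "{0..} \<inter> ?\<psi> -` {0} = S" by (auto simp: S_def)
  moreover have "bounded S"
  proof -
    obtain B where "B \<ge> 0" "\<forall>b\<ge>B. 0 < ?\<psi> b" using large by blast
    then have "S \<subseteq> {0..B}" by (auto simp: S_def) (metis less_irrefl linear)
    then show ?thesis by (rule bounded_subset[rotated]) simp
  qed
  moreover have "0 \<in> S" by (simp add: S_def laplace_exponent_def)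
  ultimately obtain s where s: "s \<in> S" "\<And>t. t \<in> S \<Longrightarrow> t \<le> s"
    using compact_attains_sup[of S] by (auto simp: compact_eq_bounded_closed)
  have Phi: "Phi0 lam = s"
    unfolding Phi0_def using s by (intro Greatest_equality) (auto simp: S_def)
  show b0: "0 < \<beta>" using \<beta> s(1) Phi by (simp add: S_def)
  show "0 < ?\<psi> \<beta>"
  proof (rule ccontr)
    assume neg: "\<not> 0 < ?\<psi> \<beta>"
    obtain B where B: "\<beta> \<le> B" "0 < ?\<psi> B" using large by blast
    have "continuous_on {\<beta>..B} ?\<psi>"
      using b0 by (intro continuous_on_subset[OF cont]) auto
    then obtain t where "\<beta> \<le> t" "?\<psi> t = 0"
      using IVT'[of ?\<psi> \<beta> 0 B] neg B by auto
    then have "t \<in> S" using b0 by (simp add: S_def)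
    then show False using s(2)[of t] \<open>\<beta> \<le> t\<close> \<beta> Phi by simp
  qed
qed

end

section \<open>Exit from a strip\<close>

lemma closed_lattice: "0 < h \<Longrightarrow> closed (lattice h)"
proof -
  assume h: "0 < h"
  have "lattice h = (\<lambda>x. x / h) -` \<int>"
    using h by (auto simp: lattice_def Ints_def field_simps)
  then show ?thesis
    by (simp, intro closed_vimage closed_Ints) (use h in \<open>auto intro!: continuous_intros\<close>)
qed

text \<open>Right continuity carries a closed condition from the countable set of rational times to
  all times, so that a single exceptional null set suffices.\<close>

lemma cadlag_in_closed:
  assumes x: "cadlag x" and C: "closed C" and rat: "\<And>q. q \<in> \<rat> \<Longrightarrow> 0 \<le> q \<Longrightarrow> x q \<in> C" and t: "0 \<le> t"
  shows "x t \<in> C"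
proof (rule ccontr)
  assume "x t \<notin> C"
  moreover have "(x \<longlongrightarrow> x t) (at_right t)"
    using x t by (auto simp: cadlag_def continuous_within)
  ultimately have "eventually (\<lambda>s. x s \<in> - C) (at_right t)"
    using C by (intro topological_tendstoD) auto
  then obtain b where b: "t < b" "\<And>s. t < s \<Longrightarrow> s < b \<Longrightarrow> x s \<notin> C"
    by (auto simp: eventually_at_right_field)
  obtain q where "q \<in> \<rat>" "t < q" "q < b" using Rats_dense_in_real[OF b(1)] by auto
  then show False using b(2) rat t by (meson less_imp_le order.trans)
qed

text \<open>The form that right continuity takes for integer-valued paths.\<close>

definition right_constant :: "(real \<Rightarrow> int) \<Rightarrow> bool" where
  "right_constant u \<longleftrightarrow> (\<forall>t\<ge>0. \<exists>e>0. \<forall>s. t \<le> s \<and> s < t + e \<longrightarrow> u s = u t)"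

text \<open>The infimum of the exit times is attained: a path in \<open>S\<close> at the infimum
  would stay in \<open>S\<close> for some further time.\<close>

lemma first_exit:
  assumes u: "right_constant u" and t: "0 \<le> t" "u t \<notin> S"
  obtains \<tau> where "0 \<le> \<tau>" "u \<tau> \<notin> S" "\<And>s. 0 \<le> s \<Longrightarrow> s < \<tau> \<Longrightarrow> u s \<in> S"
proof
  let ?E = "{t. 0 \<le> t \<and> u t \<notin> S}"
  have E: "?E \<noteq> {}" "bdd_below ?E" using t by (auto intro!: bdd_belowI[of _ 0])
  show nn: "0 \<le> Inf ?E" using E by (intro cInf_greatest) auto
  show before: "u s \<in> S" if "0 \<le> s" "s < Inf ?E" for s
    using cInf_lower[OF _ E(2), of s] that by (metis (mono_tags, lifting) leD mem_Collect_eq)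
  show "u (Inf ?E) \<notin> S"
  proof
    assume i: "u (Inf ?E) \<in> S"
    obtain e where e: "0 < e" "\<And>s. Inf ?E \<le> s \<Longrightarrow> s < Inf ?E + e \<Longrightarrow> u s = u (Inf ?E)"
      using u nn unfolding right_constant_def by blast
    have "Inf ?E + e \<le> Inf ?E"
    proof (rule cInf_greatest[OF E(1)])
      fix s assume "s \<in> ?E"
      then show "Inf ?E + e \<le> s"
        using e(2)[of s] i cInf_lower[OF _ E(2), of s] by (metis (mono_tags, lifting) mem_Collect_eq not_le)
    qed
    with e(1) show False by simp
  qed
qed

text \<open>The discrete skeleton of mesh \<open>\<delta>\<close>, absorbed at its first value
  outside \<open>S\<close>. On a coarse grid this value can differ from the true exit value.\<close>

primrec stopped :: "(real \<Rightarrow> int) \<Rightarrow> int set \<Rightarrow> real \<Rightarrow> nat \<Rightarrow> int" where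
  "stopped u S \<delta> 0 = u 0"
| "stopped u S \<delta> (Suc k) = (if stopped u S \<delta> k \<in> S then u (\<delta> * real (Suc k)) else stopped u S \<delta> k)"

lemma stopped_in: "stopped u S \<delta> k \<in> S \<Longrightarrow> stopped u S \<delta> k = u (\<delta> * real k)"
  by (induction k) (auto split: if_splits)

lemma stopped_exit:
  assumes "\<And>i. i < k0 \<Longrightarrow> u (\<delta> * real i) \<in> S" "u (\<delta> * real k0) \<notin> S" "k0 \<le> k"
  shows "stopped u S \<delta> k = u (\<delta> * real k0)"
proof -
  have "k \<le> k0 \<Longrightarrow> stopped u S \<delta> k = u (\<delta> * real k)" for k
    using assms(1) by (induction k) auto
  then have "stopped u S \<delta> k0 = u (\<delta> * real k0)" by simp
  with assms(3) show ?thesis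
    using assms(2) by (induction k rule: dec_induct) auto
qed

text \<open>The exit value persists on some \<open>[\<tau>, \<tau> + e)\<close>. A mesh below
  \<open>e\<close> cannot miss it, and no grid point before \<open>\<tau>\<close> lies outside
  \<open>S\<close>.\<close>

lemma stopped_eventually:
  assumes u: "right_constant u" and \<tau>: "0 \<le> \<tau>" "u \<tau> \<notin> S" "\<And>s. 0 \<le> s \<Longrightarrow> s < \<tau> \<Longrightarrow> u s \<in> S"
  shows "\<forall>\<^sub>F m in sequentially. stopped u S (1 / real (Suc m) ^ 2) (Suc m ^ 3) = u \<tau>"
proof -
  obtain e where e: "0 < e" "\<And>s. \<tau> \<le> s \<Longrightarrow> s < \<tau> + e \<Longrightarrow> u s = u \<tau>"
    using u \<tau>(1) unfolding right_constant_def by blast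
  \<comment> \<open>Beyond \<open>m0\<close> the horizon \<open>m + 1\<close> exceeds
    \<open>\<tau> + 1\<close> and the mesh is smaller than \<open>e\<close>.\<close>
  obtain m0 :: nat where m0: "max (\<tau> + 1) (1 / e) < real m0" using reals_Archimedean2 by blast
  show ?thesis
  proof (rule eventually_sequentiallyI[of m0])
    fix m assume "m0 \<le> m"
    then have m: "\<tau> + 1 < real (Suc m)" "1 / e < real (Suc m)" using m0 by auto
    define d where "d = 1 / real (Suc m) ^ 2"
    have d: "0 < d" "d \<le> 1" by (auto simp: d_def)
    have "d \<le> 1 / real (Suc m)" by (simp add: d_def power2_eq_square divide_simps)
    also have "\<dots> < e" using m(2) e(1) by (simp add: field_simps)
    finally have de: "d < e" .
    \<comment> \<open>The index of the first grid time not before \<open>\<tau>\<close>.\<close>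
    define k0 where "k0 = nat \<lceil>\<tau> / d\<rceil>"
    have "real k0 = of_int \<lceil>\<tau> / d\<rceil>" using \<tau>(1) d by (simp add: k0_def)
    then have "\<tau> / d \<le> real k0" "real k0 < \<tau> / d + 1" by linarith+
    then have k0: "\<tau> \<le> d * real k0" "d * real k0 < \<tau> + d" using d by (auto simp: field_simps)
    have uk: "u (d * real k0) = u \<tau>" using k0 de by (intro e(2)) auto
    have "d * real k0 < d * real (Suc m ^ 3)"
    proof -
      have "1 / x ^ 2 * x ^ 3 = x" if "0 < x" for x :: real
        using that by (simp add: power2_eq_square power3_eq_cube)
      from this[of "real (Suc m)"] have "d * real (Suc m ^ 3) = real (Suc m)"
        unfolding d_def of_nat_power by simp
      then show ?thesis using k0 d m(1) by linarith
    qed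
    then have le: "k0 \<le> Suc m ^ 3" using d by (simp only: mult_less_cancel_left_pos of_nat_less_iff)
    have "u (d * real i) \<in> S" if "i < k0" for i
    proof (rule \<tau>(3))
      have "int i < \<lceil>\<tau> / d\<rceil>" using that by (simp add: k0_def zless_nat_eq_int_zless)
      then show "d * real i < \<tau>" using d by (simp add: less_ceiling_iff field_simps)
    qed (use d in simp)
    then have "stopped u S d (Suc m ^ 3) = u (d * real k0)"
      by (rule stopped_exit) (use \<tau>(2) uk le in auto)
    then show "stopped u S (1 / real (Suc m) ^ 2) (Suc m ^ 3) = u \<tau>"
      unfolding uk by (simp add: d_def)
  qed
qed

section \<open>Consequences of the usual conditions\<close>

context usual_conditions
begin

lemma sets_F_imp_events: "0 \<le> t \<Longrightarrow> A \<in> sets (F t) \<Longrightarrow> A \<in> events"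
  using subalgebra_F[of t] by (auto simp: subalgebra_def)

lemma space_F: "0 \<le> t \<Longrightarrow> space (F t) = space M"
  using subalgebra_F[of t] by (auto simp: subalgebra_def)

lemma measurable_F_mono: "0 \<le> s \<Longrightarrow> s \<le> t \<Longrightarrow> f \<in> measurable (F s) N \<Longrightarrow> f \<in> measurable (F t) N"
  using F_mono[of s t] space_F by (intro measurable_from_subalg[of "F t" "F s"]) (auto simp: subalgebra_def)

text \<open>The usual conditions make the probability space complete. This is how sets defined by
  infima over uncountably many times become measurable.\<close>

lemma AE_eq_imp_event:
  assumes A: "A \<subseteq> space M" and B: "B \<in> events" and ae: "AE \<omega> in M. \<omega> \<in> A \<longleftrightarrow> \<omega> \<in> B"
  shows "A \<in> events" "prob A = prob B"
proof -
  obtain N where N: "{\<omega>\<in>space M. \<not> (\<omega> \<in> A \<longleftrightarrow> \<omega> \<in> B)} \<subseteq> N" "N \<in> null_sets M"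
    using AE_E[OF ae] by (metis null_setsI)
  have "A \<inter> N \<in> null_sets (completion M)"
    using N(2) by (auto simp: null_sets_completion_iff2)
  then have "A \<inter> N \<in> events"
    using null_sets_F sets_F_imp_events[of 0] by simp
  moreover have "A = (B - N) \<union> (A \<inter> N)"
    using N(1) A B sets.sets_into_space[OF B] by blast
  ultimately show "A \<in> events" using N(2) B by (metis null_setsD2 sets.Diff sets.Un)
  then show "prob A = prob B" using ae B by (intro finite_measure_eq_AE)
qed

end

section \<open>Lattice paths and their increments\<close>

context upwards_skip_free_levy_chain
begin

abbreviation (input) "steps_pmf \<equiv> compound_poisson_pmf down_pmf"

definition level :: "real \<Rightarrow> 'a \<Rightarrow> int" where
  "level t \<omega> = \<lfloor>X t \<omega> / h\<rfloor>"

lemma X_measurable: "0 \<le> t \<Longrightarrow> X t \<in> borel_measurable M"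
  using X_adapted subalgebra_F by (metis measurable_from_subalg)

lemma level_adapted: "0 \<le> t \<Longrightarrow> level t \<in> measurable (F t) (count_space UNIV)"
  unfolding level_def using X_adapted[of t] by measurable

lemma level_measurable: "0 \<le> t \<Longrightarrow> level t \<in> measurable M (count_space UNIV)"
  by (rule measurable_from_subalg[OF subalgebra_F level_adapted])

lemma distr_increment:
  assumes "0 \<le> s" "s < t"
  shows "distr M borel (\<lambda>\<omega>. X t \<omega> - X s \<omega>) =
    distr (steps_pmf (rate * (t - s))) borel (\<lambda>i. h * of_int i)"
  using X_stationary_increments[of s t] distr_X[of "t - s"] assms by simp

text \<open>At a fixed time this is read off the law; rational times are countably many, and
  \<open>cadlag_in_closed\<close> extends the statement to all times.\<close>

lemma AE_X_lattice: "AE \<omega> in M. \<forall>t\<ge>0. X t \<omega> \<in> lattice h"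
proof -
  have "AE \<omega> in M. X t \<omega> \<in> lattice h" if t: "0 \<le> t" for t
  proof (cases "t = 0")
    case True
    have "0 \<in> lattice h" by (auto simp: lattice_def intro: exI[of _ 0])
    then show ?thesis using X_zero True by (auto elim!: eventually_mono)
  next
    case False
    have [measurable]: "lattice h \<in> sets borel" using closed_lattice[OF h_pos] by simp
    have "AE x in distr (steps_pmf (rate * t)) borel (\<lambda>i. h * of_int i). x \<in> lattice h"
      by (subst AE_distr_iff) (auto simp: lattice_def)
    then have "AE x in distr M borel (X t). x \<in> lattice h"
      using False t by (subst distr_X) auto
    then show ?thesis
      using X_measurable[OF t] by (subst (asm) AE_distr_iff) auto
  qed
  then have "AE \<omega> in M. \<forall>q\<in>\<rat> \<inter> {0..}. X q \<omega> \<in> lattice h"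
    using countable_rat by (subst AE_ball_countable) auto
  then show ?thesis
    using AE_space
  proof eventually_elim
    case (elim \<omega>)
    then show ?case
      using cadlag_in_closed[OF X_cadlag closed_lattice[OF h_pos]] by auto
  qed
qed

lemma X_eq_level: "X t \<omega> \<in> lattice h \<Longrightarrow> X t \<omega> = h * of_int (level t \<omega>)"
  using h_pos by (auto simp: lattice_def level_def)

text \<open>Two lattice values at distance less than \<open>h\<close> coincide.\<close>

lemma right_constant_level:
  assumes \<omega>: "\<omega> \<in> space M" and lat: "\<forall>t\<ge>0. X t \<omega> \<in> lattice h"
  shows "right_constant (\<lambda>t. level t \<omega>)"
  unfolding right_constant_def
proof (intro allI impI)
  fix t :: real assume t: "0 \<le> t"
  have "((\<lambda>s. X s \<omega>) \<longlongrightarrow> X t \<omega>) (at_right t)"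
    using X_cadlag[OF \<omega>] t by (auto simp: cadlag_def continuous_within)
  then have "\<forall>\<^sub>F s in at_right t. dist (X s \<omega>) (X t \<omega>) < h"
    using h_pos by (rule tendstoD)
  then obtain b where b: "t < b" "\<And>s. t < s \<Longrightarrow> s < b \<Longrightarrow> \<bar>X s \<omega> - X t \<omega>\<bar> < h"
    by (auto simp: eventually_at_right_field dist_real_def)
  show "\<exists>e>0. \<forall>s. t \<le> s \<and> s < t + e \<longrightarrow> level s \<omega> = level t \<omega>"
  proof (intro exI[of _ "b - t"] conjI allI impI)
    fix s assume s: "t \<le> s \<and> s < t + (b - t)"
    show "level s \<omega> = level t \<omega>"
    proof (cases "s = t")
      case False
      then have "\<bar>X s \<omega> - X t \<omega>\<bar> < h" using s by (intro b(2)) auto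
      also have "X s \<omega> - X t \<omega> = h * of_int (level s \<omega> - level t \<omega>)"
        using X_eq_level lat s t by (simp add: algebra_simps)
      finally have "\<bar>real_of_int (level s \<omega> - level t \<omega>)\<bar> < 1"
        using h_pos by (simp add: abs_mult)
      then show ?thesis by linarith
    qed simp
  qed (use b in simp)
qed

text \<open>Independence says that the image of the measure restricted to \<open>A\<close> under the
  increment is \<open>prob A\<close> times the law of the increment.\<close>

lemma expectation_increment:
  fixes f :: "int \<Rightarrow> real"
  assumes st: "0 \<le> s" "s < t" and A: "A \<in> sets (F s)" and f: "\<And>i. \<bar>f i\<bar> \<le> 1"
  shows "expectation (\<lambda>\<omega>. indicator A \<omega> * f (level t \<omega> - level s \<omega>)) =
    prob A * (LINT i|steps_pmf (rate * (t - s)). f i)"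
proof -
  let ?D = "\<lambda>\<omega>. X t \<omega> - X s \<omega>" and ?g = "\<lambda>x. f \<lfloor>x / h\<rfloor>"
  have [measurable]: "?D \<in> borel_measurable M" "level t \<in> measurable M (count_space UNIV)"
      "level s \<in> measurable M (count_space UNIV)"
    using X_measurable[of t] X_measurable[of s] level_measurable[of t] level_measurable[of s] st by auto
  have [measurable]: "A \<in> events" using sets_F_imp_events[OF st(1) A] .
  have "expectation (\<lambda>\<omega>. indicator A \<omega> * f (level t \<omega> - level s \<omega>)) =
      expectation (\<lambda>\<omega>. indicator A \<omega> * ?g (?D \<omega>))"
  proof (rule integral_cong_AE)
    show "AE \<omega> in M. indicator A \<omega> * f (level t \<omega> - level s \<omega>) = indicator A \<omega> * ?g (?D \<omega>)"
      using AE_X_lattice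
    proof eventually_elim
      case (elim \<omega>)
      have "?D \<omega> = h * of_int (level t \<omega> - level s \<omega>)"
        using X_eq_level elim st by (simp add: algebra_simps)
      then have "\<lfloor>?D \<omega> / h\<rfloor> = level t \<omega> - level s \<omega>" using h_pos by simp
      then show ?case by simp
    qed
  qed auto
  also have "\<dots> = (LINT \<omega>|density M (indicator A). ?g (?D \<omega>))"
    by (subst integral_real_density[symmetric]) (auto simp: ennreal_indicator)
  also have "\<dots> = (LINT x|distr (density M (indicator A)) borel ?D. ?g x)"
    by (subst integral_distr) auto
  also have "distr (density M (indicator A)) borel ?D = density (distr M borel ?D) (\<lambda>_. ennreal (prob A))"
  proof (rule measure_eqI)
    fix B assume "B \<in> sets (distr (density M (indicator A)) borel ?D)"
    then have [measurable]: "B \<in> sets borel" by simp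
    have "emeasure (distr (density M (indicator A)) borel ?D) B = emeasure M (A \<inter> (?D -` B \<inter> space M))"
      by (subst emeasure_distr) (auto intro!: emeasure_restricted)
    also have "\<dots> = ennreal (prob A) * emeasure M (?D -` B \<inter> space M)"
    proof -
      have "?D -` B \<inter> space M \<in> {?D -` B \<inter> space M |B. B \<in> sets borel}"
        using \<open>B \<in> sets borel\<close> by (intro CollectI exI[of _ B]) simp
      from indep_setD[OF X_indep_increments[OF st(1) less_imp_le[OF st(2)]] A this]
      show ?thesis by (simp add: emeasure_eq_measure ennreal_mult[symmetric])
    qed
    also have "\<dots> = emeasure (density (distr M borel ?D) (\<lambda>_. ennreal (prob A))) B"
      by (simp add: emeasure_density_const emeasure_distr)
    finally show "emeasure (distr (density M (indicator A)) borel ?D) B = \<dots>" .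
  qed simp
  also have "(LINT x|density (distr M borel ?D) (\<lambda>_. ennreal (prob A)). ?g x) =
      prob A * (LINT x|distr M borel ?D. ?g x)"
    by (subst integral_real_density) auto
  also have "(LINT x|distr M borel ?D. ?g x) = (LINT i|steps_pmf (rate * (t - s)). f i)"
    unfolding distr_increment[OF st] using h_pos by (subst integral_distr) auto
  finally show ?thesis .
qed

lemma stopped_adapted:
  assumes "0 \<le> \<delta>"
  shows "(\<lambda>\<omega>. stopped (\<lambda>t. level t \<omega>) S \<delta> k) \<in> measurable (F (\<delta> * real k)) (count_space UNIV)"
proof (induction k)
  case (Suc k)
  have [measurable]: "(\<lambda>\<omega>. stopped (\<lambda>t. level t \<omega>) S \<delta> k) \<in> measurable (F (\<delta> * real (Suc k))) (count_space UNIV)"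
    using assms by (intro measurable_F_mono[OF _ _ Suc]) (auto intro!: mult_left_mono)
  have [measurable]: "level (\<delta> * real (Suc k)) \<in> measurable (F (\<delta> * real (Suc k))) (count_space UNIV)"
    using assms by (intro level_adapted) simp
  show ?case unfolding stopped.simps by measurable
qed (simp add: level_adapted)

text \<open>Outside \<open>S\<close> nothing changes. On the event that the current value is
  \<open>i \<in> S\<close>, which is known at the start of the step, the increment is independent
  and harmonicity bounds the expected change; these events are disjoint, so the bounds add up to one
  of the same size.\<close>

lemma expectation_stopped_step:
  fixes f :: "int \<Rightarrow> real"
  assumes \<delta>: "0 < \<delta>" and S: "finite S" and f: "\<And>i. 0 \<le> f i" "\<And>i. f i \<le> 1"
    and harm: "\<And>i. i \<in> S \<Longrightarrow> (LINT d|down_pmf. f (i + (1 - int d))) = f i"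
  shows "\<bar>expectation (\<lambda>\<omega>. f (stopped (\<lambda>t. level t \<omega>) S \<delta> (Suc k))) -
      expectation (\<lambda>\<omega>. f (stopped (\<lambda>t. level t \<omega>) S \<delta> k))\<bar> \<le> (rate * \<delta>)\<^sup>2"
proof -
  let ?Z = "\<lambda>k \<omega>. stopped (\<lambda>t. level t \<omega>) S \<delta> k"
  define s t where "s = \<delta> * real k" and "t = \<delta> * real (Suc k)"
  let ?A = "\<lambda>i. {\<omega> \<in> space M. ?Z k \<omega> = i}"
  have st: "0 \<le> s" "s < t" "t - s = \<delta>" using \<delta> by (auto simp: s_def t_def algebra_simps)
  have f1: "\<bar>f i\<bar> \<le> 1" for i using f[of i] by simp
  have Zm[measurable]: "?Z k \<in> measurable M (count_space UNIV)" for k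
    using stopped_adapted[of \<delta> S k] subalgebra_F[of "\<delta> * real k"] \<delta> by (auto intro: measurable_from_subalg)
  have [measurable]: "level s \<in> measurable M (count_space UNIV)" "level t \<in> measurable M (count_space UNIV)"
    using st by (auto intro!: level_measurable)
  have A: "?A i \<in> sets (F s)" for i
    using measurable_sets[OF stopped_adapted[of \<delta> S k], of "{i}"] \<delta> space_F[OF st(1)]
    by (simp add: vimage_def Int_def conj_commute s_def)
  have int: "integrable M (\<lambda>\<omega>. g \<omega>)" if "g \<in> borel_measurable M" "\<And>\<omega>. \<bar>g \<omega>\<bar> \<le> 1" for g :: "'a \<Rightarrow> real"
    using that by (intro integrable_const_bound[where B=1]) auto
  have intf: "integrable M (\<lambda>\<omega>. f (?Z k \<omega>))" for k using f1 by (intro int) auto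
  have int2: "integrable M (\<lambda>\<omega>. indicator (?A i) \<omega> * f (i + (level t \<omega> - level s \<omega>)))" for i
    using f1 by (intro int) (auto simp: abs_mult split: split_indicator)
  have int3: "integrable M (\<lambda>\<omega>. indicator (?A i) \<omega> * f i)" for i
    using f1 by (intro int) (auto simp: abs_mult split: split_indicator)
  have "expectation (\<lambda>\<omega>. f (?Z (Suc k) \<omega>)) - expectation (\<lambda>\<omega>. f (?Z k \<omega>)) =
      expectation (\<lambda>\<omega>. f (?Z (Suc k) \<omega>) - f (?Z k \<omega>))"
    by (rule Bochner_Integration.integral_diff[OF intf intf, symmetric])
  also have "\<dots> = expectation (\<lambda>\<omega>. \<Sum>i\<in>S. indicator (?A i) \<omega> * f (i + (level t \<omega> - level s \<omega>)) - indicator (?A i) \<omega> * f i)"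
  proof (rule Bochner_Integration.integral_cong[OF refl])
    fix \<omega> assume \<omega>: "\<omega> \<in> space M"
    let ?h = "\<lambda>i. f (i + (level t \<omega> - level s \<omega>)) - f i"
    have "(\<Sum>i\<in>S. indicator (?A i) \<omega> * f (i + (level t \<omega> - level s \<omega>)) - indicator (?A i) \<omega> * f i) =
        (\<Sum>i\<in>S. if i = ?Z k \<omega> then ?h i else 0)"
      using \<omega> by (intro sum.cong refl) (auto split: split_indicator)
    also have "\<dots> = (if ?Z k \<omega> \<in> S then ?h (?Z k \<omega>) else 0)"
      using S by (simp add: sum.delta)
    also have "\<dots> = f (?Z (Suc k) \<omega>) - f (?Z k \<omega>)"
      using stopped_in[of "\<lambda>t. level t \<omega>" S \<delta> k] by (auto simp: s_def t_def)
    finally show "f (?Z (Suc k) \<omega>) - f (?Z k \<omega>) =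
        (\<Sum>i\<in>S. indicator (?A i) \<omega> * f (i + (level t \<omega> - level s \<omega>)) - indicator (?A i) \<omega> * f i)" ..
  qed
  also have "\<dots> = (\<Sum>i\<in>S. expectation (\<lambda>\<omega>. indicator (?A i) \<omega> * f (i + (level t \<omega> - level s \<omega>))) -
      expectation (\<lambda>\<omega>. indicator (?A i) \<omega> * f i))"
    using int2 int3 by (subst Bochner_Integration.integral_sum) (auto intro!: sum.cong Bochner_Integration.integral_diff)
  also have "\<dots> = (\<Sum>i\<in>S. prob (?A i) * ((LINT j|steps_pmf (rate * \<delta>). f (i + j)) - f i))"
  proof (intro sum.cong refl)
    fix i
    have "expectation (\<lambda>\<omega>. indicator (?A i) \<omega> * f (i + (level t \<omega> - level s \<omega>))) =
        prob (?A i) * (LINT j|steps_pmf (rate * \<delta>). f (i + j))"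
      using expectation_increment[OF st(1,2) A, of "\<lambda>j. f (i + j)"] f1 st(3) by simp
    then show "expectation (\<lambda>\<omega>. indicator (?A i) \<omega> * f (i + (level t \<omega> - level s \<omega>))) -
        expectation (\<lambda>\<omega>. indicator (?A i) \<omega> * f i) =
        prob (?A i) * ((LINT j|steps_pmf (rate * \<delta>). f (i + j)) - f i)"
      by (simp add: right_diff_distrib)
  qed
  finally have "\<bar>expectation (\<lambda>\<omega>. f (?Z (Suc k) \<omega>)) - expectation (\<lambda>\<omega>. f (?Z k \<omega>))\<bar> \<le>
      (\<Sum>i\<in>S. \<bar>prob (?A i) * ((LINT j|steps_pmf (rate * \<delta>). f (i + j)) - f i)\<bar>)"
    by (simp add: sum_abs)
  also have "\<dots> \<le> (\<Sum>i\<in>S. prob (?A i) * (rate * \<delta>)\<^sup>2)"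
  proof (intro sum_mono)
    fix i assume "i \<in> S"
    \<comment> \<open>The summand \<open>0\<close> exhibits the value at the origin of the shifted
      function \<open>j \<mapsto> f (i + j)\<close>.\<close>
    then have "\<bar>(LINT j|steps_pmf (rate * \<delta>). f (i + j)) - f (i + 0)\<bar> \<le> (rate * \<delta>)\<^sup>2"
      using rate_pos \<delta> f harm by (intro compound_poisson_harmonic_bound) auto
    then show "\<bar>prob (?A i) * ((LINT j|steps_pmf (rate * \<delta>). f (i + j)) - f i)\<bar> \<le> prob (?A i) * (rate * \<delta>)\<^sup>2"
      by (simp add: abs_mult mult_left_mono)
  qed
  also have "\<dots> = prob (\<Union>i\<in>S. ?A i) * (rate * \<delta>)\<^sup>2"
    using S by (subst finite_measure_finite_Union) (auto simp: disjoint_family_on_def sum_distrib_right)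
  also have "\<dots> \<le> 1 * (rate * \<delta>)\<^sup>2"
    by (intro mult_right_mono prob_le_1) simp
  finally show ?thesis by simp
qed

text \<open>To remain in the strip at all integer times, every unit increment must be below
  \<open>b - a\<close>. By independence the probability of this for \<open>k\<close> steps is at
  most \<open>?q ^ k\<close>, and \<open>?q < 1\<close> since increments are unbounded
  above.\<close>

lemma AE_exit:
  shows "AE \<omega> in M. \<exists>t\<ge>0. level t \<omega> \<notin> {a..<b}"
proof -
  let ?S = "{a..<b}"
  let ?q = "measure_pmf.prob (steps_pmf rate) {..<b - a}"
  define B where "B k = {\<omega> \<in> space M. \<forall>i\<le>k. level (real i) \<omega> \<in> ?S}" for k :: nat
  have [measurable]: "level (real i) \<in> measurable M (count_space UNIV)" for i
    by (rule level_measurable) simp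
  have BF: "B k \<in> sets (F (real k))" for k
  proof -
    have "level (real i) \<in> measurable (F (real k)) (count_space UNIV)" if "i \<le> k" for i
      using that by (intro measurable_F_mono[OF _ _ level_adapted]) auto
    then have "(\<Inter>i\<in>{..k}. level (real i) -` ?S \<inter> space (F (real k))) \<in> sets (F (real k))"
      by (intro sets.finite_INT) (auto intro: measurable_sets)
    also have "(\<Inter>i\<in>{..k}. level (real i) -` ?S \<inter> space (F (real k))) = B k"
      by (auto simp: B_def space_F)
    finally show ?thesis .
  qed
  have Bev[measurable]: "B k \<in> events" for k using BF sets_F_imp_events[of "real k"] by simp
  have q: "?q < 1"
  proof -
    have "?q = 1 - measure_pmf.prob (steps_pmf rate) {b - a..}"
      by (subst measure_pmf.prob_compl[symmetric]) (auto intro!: arg_cong[where f="measure _"])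
    then show ?thesis
      using compound_poisson_pmf_unbounded[OF rate_pos down_pmf_0, of "b - a"] by simp
  qed
  have Bk: "prob (B k) \<le> ?q ^ k" for k
  proof (induction k)
    case (Suc k)
    have "prob (B (Suc k)) = expectation (indicator (B (Suc k)))" by simp
    also have "\<dots> \<le> expectation (\<lambda>\<omega>. indicator (B k) \<omega> * indicator {..<b - a} (level (real (Suc k)) \<omega> - level (real k) \<omega>))"
    proof (rule integral_mono)
      fix \<omega> assume "\<omega> \<in> space M"
      have "level (real (Suc k)) \<omega> - level (real k) \<omega> < b - a" if "\<omega> \<in> B (Suc k)"
      proof -
        have "level (real (Suc k)) \<omega> \<in> ?S" "level (real k) \<omega> \<in> ?S"
          using that unfolding B_def by (blast intro: le_SucI)+
        then show ?thesis by simp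
      qed
      moreover have "\<omega> \<in> B (Suc k) \<Longrightarrow> \<omega> \<in> B k" by (auto simp: B_def)
      ultimately show "indicat_real (B (Suc k)) \<omega> \<le> indicator (B k) \<omega> * indicator {..<b - a} (level (real (Suc k)) \<omega> - level (real k) \<omega>)"
        by (auto split: split_indicator)
    next
      show "integrable M (indicat_real (B (Suc k)))"
        by (simp add: emeasure_eq_measure)
      show "integrable M (\<lambda>\<omega>. indicat_real (B k) \<omega> * indicator {..<b - a} (level (real (Suc k)) \<omega> - level (real k) \<omega>))"
      proof (rule integrable_const_bound[where B=1])
        show "(\<lambda>\<omega>. indicat_real (B k) \<omega> * indicator {..<b - a} (level (real (Suc k)) \<omega> - level (real k) \<omega>)) \<in> borel_measurable M"
          by measurable
      qed (auto split: split_indicator)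
    qed
    also have "\<dots> = prob (B k) * ?q"
      by (subst expectation_increment[OF _ _ BF]) (auto split: split_indicator)
    also have "\<dots> \<le> ?q ^ Suc k" using mult_right_mono[OF Suc, of ?q] by (simp add: mult.commute)
    finally show ?case .
  qed simp
  have "prob (\<Inter>k. B k) \<le> ?q ^ k" for k
    by (rule order.trans[OF finite_measure_mono Bk]) auto
  moreover have "(\<lambda>k. ?q ^ k) \<longlonglongrightarrow> 0" using q by (intro LIMSEQ_realpow_zero) auto
  ultimately have "prob (\<Inter>k. B k) \<le> 0" by (intro LIMSEQ_le_const) auto
  then have "prob (\<Inter>k. B k) = 0" by (simp add: measure_le_0_iff)
  then have "(\<Inter>k. B k) \<in> null_sets M" by (simp add: emeasure_eq_measure null_setsI)
  moreover have "\<omega> \<in> (\<Inter>k. B k)" if "\<omega> \<in> space M" "\<not> (\<exists>t\<ge>0. level t \<omega> \<notin> ?S)" for \<omega>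
    using that unfolding B_def by auto
  ultimately show ?thesis by (intro AE_I'[of "\<Inter>k. B k"]) auto
qed

text \<open>The witness \<open>\<tau>\<close> is necessarily the first exit time from the strip;
  infima and infinite times are thereby avoided.\<close>

definition exits_upwards :: "nat \<Rightarrow> nat \<Rightarrow> 'a \<Rightarrow> bool" where
  "exits_upwards n k \<omega> \<longleftrightarrow>
     (\<exists>\<tau>\<ge>0. int k \<le> level \<tau> \<omega> \<and> (\<forall>s. 0 \<le> s \<longrightarrow> s < \<tau> \<longrightarrow> level s \<omega> \<in> {- int n..<int k}))"

text \<open>The chain is observed on the grid of mesh \<open>1 / (m + 1)\<^sup>2\<close> up to time \<open>m + 1\<close>: stopping it at
  its exit from the strip changes the expectation of the harmonic function by \<open>O(1 / m)\<close> in total,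
  and almost every path eventually exits at the right value.\<close>

lemma prob_exits_upwards:
  assumes A: "A \<subseteq> space M" and ae: "AE \<omega> in M. \<omega> \<in> A \<longleftrightarrow> exits_upwards n k \<omega>"
  shows "A \<in> events" "prob A = scale_seq down_pmf n / scale_seq down_pmf (n + k)"
proof -
  let ?S = "{- int n..<int k}"
  \<comment> \<open>Shifting levels by \<open>n\<close> moves the strip to
    \<open>{0..<n + k}\<close>, the range on which \<open>exit_prob\<close> is harmonic.\<close>
  let ?f = "\<lambda>i. exit_prob down_pmf (n + k) (i + int n)"
  let ?Z = "\<lambda>m \<omega>. stopped (\<lambda>t. level t \<omega>) ?S (1 / real (Suc m) ^ 2) (Suc m ^ 3)"
  \<comment> \<open>A limit of measurable functions; almost surely it is the indicator of upward
    exit, whose measurability is not yet known.\<close>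
  let ?L = "\<lambda>\<omega>. lim (\<lambda>m. ?f (?Z m \<omega>))"
  note fb = exit_prob_bounds[OF down_pmf_0]
  have step: "\<bar>expectation (\<lambda>\<omega>. ?f (stopped (\<lambda>t. level t \<omega>) ?S \<delta> K)) - ?f 0\<bar> \<le> real K * (rate * \<delta>)\<^sup>2"
    if \<delta>: "0 < \<delta>" for \<delta> K
  proof (induction K)
    case 0
    have [measurable]: "level 0 \<in> measurable M (count_space UNIV)"
      by (rule level_measurable) simp
    have "expectation (\<lambda>\<omega>. ?f (level 0 \<omega>)) = expectation (\<lambda>\<omega>. ?f 0)"
    proof (rule integral_cong_AE)
      show "AE \<omega> in M. ?f (level 0 \<omega>) = ?f 0"
        using X_zero by eventually_elim (simp add: level_def)
    qed auto
    then show ?case by (simp add: prob_space)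
  next
    case (Suc K)
    have "(LINT d|down_pmf. ?f (i + (1 - int d))) = ?f i" if "i \<in> ?S" for i
      using exit_prob_harmonic[OF down_pmf_0, of "i + int n" "n + k"] that by (simp add: algebra_simps)
    then have "\<bar>expectation (\<lambda>\<omega>. ?f (stopped (\<lambda>t. level t \<omega>) ?S \<delta> (Suc K))) -
        expectation (\<lambda>\<omega>. ?f (stopped (\<lambda>t. level t \<omega>) ?S \<delta> K))\<bar> \<le> (rate * \<delta>)\<^sup>2"
      by (intro expectation_stopped_step[OF \<delta>] fb) auto
    moreover have "real (Suc K) * (rate * \<delta>)\<^sup>2 = real K * (rate * \<delta>)\<^sup>2 + (rate * \<delta>)\<^sup>2"
      by (simp add: distrib_right)
    ultimately show ?case using Suc by linarith
  qed
  have Zm[measurable]: "?Z m \<in> measurable M (count_space UNIV)" for m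
  proof -
    have "?Z m \<in> measurable (F (1 / real (Suc m) ^ 2 * real (Suc m ^ 3))) (count_space UNIV)"
      by (rule stopped_adapted) simp
    then show ?thesis
      by (rule measurable_from_subalg[rotated]) (rule subalgebra_F, simp)
  qed
  have Lm[measurable]: "?L \<in> borel_measurable M" by measurable
  have lim: "AE \<omega> in M. (\<lambda>m. ?f (?Z m \<omega>)) \<longlonglongrightarrow> (if exits_upwards n k \<omega> then 1 else 0)"
    using AE_X_lattice AE_space AE_exit[of "- int n" "int k"]
  proof eventually_elim
    case (elim \<omega>)
    let ?u = "\<lambda>t. level t \<omega>"
    have rc: "right_constant ?u" using elim by (intro right_constant_level) auto
    obtain t where "0 \<le> t" "?u t \<notin> ?S" using elim(3) by blast
    from first_exit[OF rc this] obtain \<tau> where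
      \<tau>: "0 \<le> \<tau>" "?u \<tau> \<notin> ?S" "\<And>s. 0 \<le> s \<Longrightarrow> s < \<tau> \<Longrightarrow> ?u s \<in> ?S"
      by blast
    have up: "exits_upwards n k \<omega> \<longleftrightarrow> int k \<le> ?u \<tau>"
    proof
      assume "exits_upwards n k \<omega>"
      then obtain \<sigma> where \<sigma>: "0 \<le> \<sigma>" "int k \<le> ?u \<sigma>" "\<And>s. 0 \<le> s \<Longrightarrow> s < \<sigma> \<Longrightarrow> ?u s \<in> ?S"
        unfolding exits_upwards_def by blast
      \<comment> \<open>Both are first exit times: each is outside the strip, and everything before
        the other is inside.\<close>
      have "\<sigma> = \<tau>"
        using \<tau>(2) \<sigma>(3)[OF \<tau>(1)] \<sigma>(2) \<tau>(3)[OF \<sigma>(1)] by (cases \<sigma> \<tau> rule: linorder_cases) auto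
      then show "int k \<le> ?u \<tau>" using \<sigma> by simp
    qed (use \<tau> in \<open>auto simp: exits_upwards_def\<close>)
    have "?f (?u \<tau>) = (if exits_upwards n k \<omega> then 1 else 0)"
      unfolding up using \<tau>(2) by (auto simp: exit_prob_def)
    moreover have "(\<lambda>m. ?f (?Z m \<omega>)) \<longlonglongrightarrow> ?f (?u \<tau>)"
      using stopped_eventually[OF rc \<tau>] by (intro tendsto_eventually) (auto elim: eventually_mono)
    ultimately show ?case by simp
  qed
  then have L: "AE \<omega> in M. ?L \<omega> = (if exits_upwards n k \<omega> then 1 else 0)"
    by eventually_elim (rule limI)
  \<comment> \<open>A genuine event agreeing almost surely with \<open>A\<close>; completeness
    transfers measurability and probability.\<close>
  define B where "B = {\<omega> \<in> space M. ?L \<omega> = 1}"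
  have B: "B \<in> events" unfolding B_def by measurable
  have AB: "AE \<omega> in M. \<omega> \<in> A \<longleftrightarrow> \<omega> \<in> B"
    using ae L AE_space by eventually_elim (auto simp: B_def)
  show "A \<in> events" using AE_eq_imp_event[OF A B AB] by simp
  have "(\<lambda>m. expectation (\<lambda>\<omega>. ?f (?Z m \<omega>))) \<longlonglongrightarrow> expectation (indicator B)"
  proof (rule integral_dominated_convergence[where w="\<lambda>_. 1"])
    show "AE \<omega> in M. (\<lambda>m. ?f (?Z m \<omega>)) \<longlonglongrightarrow> indicator B \<omega>"
      using lim L AE_space by eventually_elim (auto simp: B_def split: if_splits)
    show "(\<lambda>\<omega>. ?f (?Z m \<omega>)) \<in> borel_measurable M" for m by measurable
  qed (use B fb in auto)
  moreover have "(\<lambda>m. expectation (\<lambda>\<omega>. ?f (?Z m \<omega>))) \<longlonglongrightarrow> ?f 0"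
  proof (rule LIM_zero_cancel, rule Lim_null_comparison)
    show "\<forall>\<^sub>F m in sequentially. norm (expectation (\<lambda>\<omega>. ?f (?Z m \<omega>)) - ?f 0) \<le> rate\<^sup>2 * (1 / real (Suc m))"
    proof (intro always_eventually allI)
      fix m
      \<comment> \<open>With \<open>x = m + 1\<close> there are \<open>x ^ 3\<close> steps, each
        with an error of order \<open>x ^ -4\<close>.\<close>
      have "x ^ 3 * (rate * (1 / x ^ 2))\<^sup>2 = rate\<^sup>2 * (1 / x)" if "0 < x" for x
        using that by (simp add: power2_eq_square power3_eq_cube)
      from this[of "real (Suc m)"]
      have "real (Suc m ^ 3) * (rate * (1 / real (Suc m) ^ 2))\<^sup>2 = rate\<^sup>2 * (1 / real (Suc m))"
        unfolding of_nat_power by simp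
      then show "norm (expectation (\<lambda>\<omega>. ?f (?Z m \<omega>)) - ?f 0) \<le> rate\<^sup>2 * (1 / real (Suc m))"
        using step[of "1 / real (Suc m) ^ 2" "Suc m ^ 3"] by simp
    qed
    show "(\<lambda>m. rate\<^sup>2 * (1 / real (Suc m))) \<longlonglongrightarrow> 0"
      using tendsto_mult_right_zero[OF LIMSEQ_inverse_real_of_nat] by (simp add: inverse_eq_divide)
  qed
  ultimately have "expectation (indicator B) = ?f 0" by (rule LIMSEQ_unique)
  then have "prob B = ?f 0" using B by simp
  moreover have "?f 0 = scale_seq down_pmf n / scale_seq down_pmf (n + k)"
    using scale_seq_pos[OF down_pmf_0, of n] by (simp add: exit_prob_def)
  ultimately show "prob A = scale_seq down_pmf n / scale_seq down_pmf (n + k)"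
    using AE_eq_imp_event[OF A B AB] by simp
qed

end

section \<open>The scale function\<close>

context upwards_skip_free_levy_chain
begin

text \<open>The first exit time from the strip is at most the passage time, so the exit value enters
  the running infimum and cannot lie below the strip if the bound holds. Conversely, after an upward
  exit the passage time is no later than the exit, and the path has not been below
  \<open>- n * h\<close> until then.\<close>

lemma running_inf_iff_exits_upwards:
  assumes rc: "right_constant (\<lambda>t. level t \<omega>)" and lat: "\<forall>t\<ge>0. X t \<omega> \<in> lattice h"
    and ex: "\<exists>t\<ge>0. level t \<omega> \<notin> {- int n..<int k}"
    and n: "n = nat \<lfloor>x / h\<rfloor>" and x: "0 \<le> x"
  shows "ereal (- x) \<le> running_inf X (passage_time X (h * real k) \<omega>) \<omega> \<longleftrightarrow> exits_upwards n k \<omega>"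
proof -
  let ?S = "{- int n..<int k}"
  obtain \<tau> where \<tau>: "0 \<le> \<tau>" "level \<tau> \<omega> \<notin> ?S" "\<And>s. 0 \<le> s \<Longrightarrow> s < \<tau> \<Longrightarrow> level s \<omega> \<in> ?S"
    using ex first_exit[OF rc] by metis
  have X: "X t \<omega> = h * of_int (level t \<omega>)" if "0 \<le> t" for t
    using X_eq_level lat that by blast
  have ge_k: "h * real k \<le> X t \<omega> \<longleftrightarrow> int k \<le> level t \<omega>" if "0 \<le> t" for t
  proof -
    have "h * real k \<le> X t \<omega> \<longleftrightarrow> real_of_int (int k) \<le> real_of_int (level t \<omega>)"
      unfolding X[OF that] using h_pos by simp
    then show ?thesis by (simp only: of_int_le_iff)
  qed
  have int_n: "int n = \<lfloor>x / h\<rfloor>" using n x h_pos by simp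
  \<comment> \<open>The path takes lattice values only, so the barrier can be rounded to the
    lattice.\<close>
  have ge_x: "- x \<le> X t \<omega> \<longleftrightarrow> - int n \<le> level t \<omega>" if "0 \<le> t" for t
  proof -
    have "- x \<le> X t \<omega> \<longleftrightarrow> real_of_int (- level t \<omega>) \<le> x / h"
      unfolding X[OF that] using h_pos by (simp add: field_simps minus_le_iff)
    also have "\<dots> \<longleftrightarrow> - level t \<omega> \<le> int n" by (simp only: int_n le_floor_iff)
    finally show ?thesis by linarith
  qed
  have pt_ge: "ereal \<tau> \<le> passage_time X (h * real k) \<omega>"
    unfolding passage_time_def
  proof (rule INF_greatest)
    fix t assume "t \<in> {t. 0 \<le> t \<and> h * real k \<le> X t \<omega>}"
    then have "0 \<le> t" "int k \<le> level t \<omega>" using ge_k by auto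
    then show "ereal \<tau> \<le> ereal t" using \<tau>(3)[of t] by (cases "t < \<tau>") auto
  qed
  show ?thesis
  proof
    assume up: "exits_upwards n k \<omega>"
    then obtain \<sigma> where \<sigma>: "0 \<le> \<sigma>" "int k \<le> level \<sigma> \<omega>" "\<And>s. 0 \<le> s \<Longrightarrow> s < \<sigma> \<Longrightarrow> level s \<omega> \<in> ?S"
      unfolding exits_upwards_def by blast
    have pt: "passage_time X (h * real k) \<omega> \<le> ereal \<sigma>"
      unfolding passage_time_def using \<sigma> ge_k by (intro INF_lower) auto
    show "ereal (- x) \<le> running_inf X (passage_time X (h * real k) \<omega>) \<omega>"
      unfolding running_inf_def
    proof (rule INF_greatest)
      fix s assume "s \<in> {s. 0 \<le> s \<and> ereal s \<le> passage_time X (h * real k) \<omega>}"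
      then have s: "0 \<le> s" "s \<le> \<sigma>" using pt by (auto dest: order.trans)
      have "- int n \<le> level s \<omega>"
      proof (cases "s = \<sigma>")
        case False
        then have "level s \<omega> \<in> ?S" using s by (intro \<sigma>(3)) auto
        then show ?thesis by simp
      qed (use \<sigma> in simp)
      then show "ereal (- x) \<le> ereal (X s \<omega>)" using ge_x[OF s(1)] by simp
    qed
  next
    assume "ereal (- x) \<le> running_inf X (passage_time X (h * real k) \<omega>) \<omega>"
    also have "\<dots> \<le> ereal (X \<tau> \<omega>)"
      unfolding running_inf_def using pt_ge \<tau>(1) by (intro INF_lower) auto
    finally have "- int n \<le> level \<tau> \<omega>" using ge_x[OF \<tau>(1)] by simp
    then show "exits_upwards n k \<omega>"
      unfolding exits_upwards_def using \<tau> by (intro exI[of _ \<tau>]) auto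
  qed
qed

lemma prob_running_inf_ge:
  fixes k :: nat
  assumes x: "0 \<le> x"
  defines "A \<equiv> {\<omega> \<in> space M. ereal (- x) \<le> running_inf X (passage_time X (h * real k) \<omega>) \<omega>}"
  shows "A \<in> events"
    and "prob A = scale_seq down_pmf (nat \<lfloor>x / h\<rfloor>) / scale_seq down_pmf (nat \<lfloor>x / h\<rfloor> + k)"
proof -
  have "AE \<omega> in M. \<omega> \<in> A \<longleftrightarrow> exits_upwards (nat \<lfloor>x / h\<rfloor>) k \<omega>"
    using AE_X_lattice AE_space AE_exit[of "- int (nat \<lfloor>x / h\<rfloor>)" "int k"]
  proof eventually_elim
    case (elim \<omega>)
    then show ?case
      using running_inf_iff_exits_upwards[OF right_constant_level _ _ refl x] by (auto simp: A_def)
  qed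
  then show "A \<in> events"
      "prob A = scale_seq down_pmf (nat \<lfloor>x / h\<rfloor>) / scale_seq down_pmf (nat \<lfloor>x / h\<rfloor> + k)"
    by (intro prob_exits_upwards; force simp: A_def)+
qed

lemma prob_first_excursion_depth_le:
  "{\<omega> \<in> space M. first_excursion_depth X h \<omega> \<le> ereal (real n * h)} \<in> events"
  "prob {\<omega> \<in> space M. first_excursion_depth X h \<omega> \<le> ereal (real n * h)} =
    scale_seq down_pmf n / scale_seq down_pmf (Suc n)"
proof -
  have eq: "{\<omega> \<in> space M. first_excursion_depth X h \<omega> \<le> ereal (real n * h)} =
      {\<omega> \<in> space M. ereal (- (real n * h)) \<le> running_inf X (passage_time X (h * real 1) \<omega>) \<omega>}"
    by (simp add: first_excursion_depth_def ereal_uminus_le_reorder)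
  have n: "nat \<lfloor>real n * h / h\<rfloor> = n" "0 \<le> real n * h" using h_pos by simp_all
  show "{\<omega> \<in> space M. first_excursion_depth X h \<omega> \<le> ereal (real n * h)} \<in> events"
    unfolding eq by (rule prob_running_inf_ge[OF n(2)])
  show "prob {\<omega> \<in> space M. first_excursion_depth X h \<omega> \<le> ereal (real n * h)} =
      scale_seq down_pmf n / scale_seq down_pmf (Suc n)"
    unfolding eq prob_running_inf_ge(2)[OF n(2)] n(1) by simp
qed

text \<open>The factor with index \<open>r\<close> is
  \<open>scale_seq down_pmf (r - 1) / scale_seq down_pmf r\<close>; the product telescopes, starting
  from the value one.\<close>

lemma scale_function_eq: "scale_function M X h x = scale_seq down_pmf (nat \<lfloor>x / h\<rfloor>)"
proof -
  have "(\<Prod>r = 1..k. prob {\<omega> \<in> space M. first_excursion_depth X h \<omega> \<le> ereal ((real r - 1) * h)}) =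
      1 / scale_seq down_pmf k" for k
  proof (induction k)
    case (Suc k)
    then show ?case
      using prob_first_excursion_depth_le(2)[of k] scale_seq_pos[OF down_pmf_0, of k]
      by (simp del: scale_seq.simps(2))
  qed simp
  then show ?thesis by (simp add: scale_function_def)
qed

text \<open>The ratios are values of the distribution function of the excursion depth. This is the
  monotonicity that \<open>summable_scale_seq\<close> requires.\<close>

lemma incseq_scale_seq_ratio: "incseq (\<lambda>n. scale_seq down_pmf n / scale_seq down_pmf (Suc n))"
proof (rule incseq_SucI)
  fix n
  have "real n * h \<le> real (Suc n) * h" using h_pos by simp
  then have "first_excursion_depth X h \<omega> \<le> ereal (real (Suc n) * h)"
    if "first_excursion_depth X h \<omega> \<le> ereal (real n * h)" for \<omega>
    using that by (meson ereal_less_eq(3) order.trans)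
  then show "scale_seq down_pmf n / scale_seq down_pmf (Suc n) \<le>
      scale_seq down_pmf (Suc n) / scale_seq down_pmf (Suc (Suc n))"
    unfolding prob_first_excursion_depth_le(2)[symmetric]
    by (intro finite_measure_mono prob_first_excursion_depth_le(1)) auto
qed

text \<open>Through \<open>z = exp (- \<beta> * h)\<close> positivity of the exponent above
  \<open>Phi0 lam\<close> becomes \<open>z < pgf down_pmf z\<close>, which gives summability. The
  factor \<open>measure lam {h}\<close> is \<open>rate * pmf down_pmf 0\<close>.\<close>

lemma laplace_scale_function:
  assumes \<beta>: "Phi0 lam < \<beta>"
  shows "has_laplace_transform (scale_function M X h) \<beta>
    (measure lam {h} * (exp (\<beta> * h) - 1) / (\<beta> * laplace_exponent lam \<beta>))"
proof -
  let ?w = "scale_seq down_pmf" and ?z = "exp (- \<beta> * h)" and ?p = "pgf down_pmf"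
  note b = above_Phi0[OF \<beta>]
  have ex: "laplace_exponent lam b = rate * (?p (exp (- b * h)) - exp (- b * h)) / exp (- b * h)" if "0 \<le> b" for b
    unfolding laplace_exponent_pgf[OF that] by (simp add: exp_minus field_simps)
  \<comment> \<open>The point corresponding to \<open>Phi0 lam\<close>; the maximum with zero makes
    \<open>?zR \<le> 1\<close> immediate.\<close>
  let ?zR = "exp (- max 0 (Phi0 lam) * h)"
  have "max 0 (Phi0 lam) * h < \<beta> * h" "0 < \<beta> * h"
    using b(1) \<beta> h_pos by (auto intro!: mult_strict_right_mono)
  then have "- \<beta> * h < - max 0 (Phi0 lam) * h" "- \<beta> * h < 0" by linarith+
  then have z: "0 < ?z" "?z < ?zR" "?z < 1" by (simp_all only: exp_less_cancel_iff exp_gt_zero exp_less_one_iff)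
  have sm: "summable (\<lambda>n. ?w n * ?z ^ n)"
  proof (rule summable_scale_seq[OF down_pmf_0 incseq_scale_seq_ratio _ _ z(1,2)])
    fix u :: real assume u: "0 < u" "u < ?zR"
    define b where "b = - ln u / h"
    have bu: "exp (- b * h) = u" using u h_pos by (simp add: b_def)
    have "ln u < - max 0 (Phi0 lam) * h" using u ln_less_cancel_iff[of u ?zR] by simp
    then have "max 0 (Phi0 lam) * h < - ln u" by linarith
    then have "max 0 (Phi0 lam) < b" unfolding b_def using h_pos by (subst pos_less_divide_eq)
    then have "0 < laplace_exponent lam b" "0 \<le> b" using above_Phi0[of b] by auto
    then have "0 < rate * (?p u - u) / u" using ex[of b] bu by simp
    then show "u < ?p u" using u rate_pos by (simp add: zero_less_divide_iff zero_less_mult_iff)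
  qed (use h_pos in simp)
  have gf: "(\<Sum>n. ?w n * ?z ^ n) * (?p ?z - ?z) = pmf down_pmf 0"
    using scale_seq_generating_function[OF down_pmf_0 _ _ sm] z by simp
  have pz: "0 < ?p ?z - ?z"
    using b(2) ex[of \<beta>] b(1) rate_pos z(1) by (simp add: zero_less_divide_iff zero_less_mult_iff)
  have "has_laplace_transform (\<lambda>x. ?w (nat \<lfloor>x / h\<rfloor>)) \<beta> ((1 - ?z) / \<beta> * (\<Sum>n. ?w n * ?z ^ n))"
    using scale_seq_pos[OF down_pmf_0] by (intro has_laplace_transform_step h_pos b sm) (auto intro: less_imp_le)
  also have "(\<Sum>n. ?w n * ?z ^ n) = pmf down_pmf 0 / (?p ?z - ?z)"
    using gf pz by (simp add: field_simps)
  also have "(1 - ?z) / \<beta> * (pmf down_pmf 0 / (?p ?z - ?z)) =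
      measure lam {h} * (exp (\<beta> * h) - 1) / (\<beta> * laplace_exponent lam \<beta>)"
  proof -
    have z1: "1 - ?z = (exp (\<beta> * h) - 1) * ?z" by (simp add: algebra_simps mult_exp_exp)
    have L: "laplace_exponent lam \<beta> = rate * (?p ?z - ?z) / ?z" using b by (intro ex) simp
    have "e * z / \<beta> * (m / rate / P) = m * e / (\<beta> * (rate * P / z))" if "0 < z" for e z m P :: real
      using that by simp
    then show ?thesis unfolding z1 L pmf_down_pmf using z(1) by simp
  qed
  finally show ?thesis by (simp add: scale_function_eq[abs_def])
qed

end

section \<open>Regularity of step functions and conclusion\<close>

lemma has_laplace_transform_cmult:
  assumes "has_laplace_transform f \<beta> v"
  shows "has_laplace_transform (\<lambda>x. c * f x) \<beta> (c * v)"
proof -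
  have "(\<lambda>x. exp (- \<beta> * x) * (c * f x)) = (\<lambda>x. c * (exp (- \<beta> * x) * f x))"
    by (simp add: fun_eq_iff)
  then show ?thesis
    using assms unfolding has_laplace_transform_def by simp
qed

lemma step_function_at_right:
  fixes w :: "nat \<Rightarrow> real"
  assumes h: "0 < h"
  shows "\<forall>\<^sub>F t in at_right x. w (nat \<lfloor>t / h\<rfloor>) = w (nat \<lfloor>x / h\<rfloor>)"
proof (rule eventually_at_rightI)
  have "x / h < of_int \<lfloor>x / h\<rfloor> + 1" by linarith
  then show "x < h * (of_int \<lfloor>x / h\<rfloor> + 1)" using h by (simp add: pos_divide_less_eq mult.commute)
  fix t assume "t \<in> {x<..<h * (of_int \<lfloor>x / h\<rfloor> + 1)}"
  then have "x / h \<le> t / h" "t / h < of_int \<lfloor>x / h\<rfloor> + 1" using h by (auto simp: field_simps)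
  then have "\<lfloor>t / h\<rfloor> = \<lfloor>x / h\<rfloor>"
    using of_int_floor_le[of "x / h"] by (intro floor_unique) linarith+
  then show "w (nat \<lfloor>t / h\<rfloor>) = w (nat \<lfloor>x / h\<rfloor>)" by simp
qed

text \<open>Just left of \<open>x\<close> the floor is the ceiling at \<open>x\<close> minus one:
  the preceding cell if \<open>x\<close> is a lattice point, otherwise the cell of \<open>x\<close>
  itself.\<close>

lemma step_function_at_left:
  fixes w :: "nat \<Rightarrow> real"
  assumes h: "0 < h"
  shows "\<forall>\<^sub>F t in at_left x. w (nat \<lfloor>t / h\<rfloor>) = w (nat (\<lceil>x / h\<rceil> - 1))"
proof (rule eventually_at_leftI)
  have "of_int \<lceil>x / h\<rceil> - 1 < x / h" by linarith
  then show "h * (of_int \<lceil>x / h\<rceil> - 1) < x" using h by (simp add: pos_less_divide_eq mult.commute)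
  fix t assume "t \<in> {h * (of_int \<lceil>x / h\<rceil> - 1)<..<x}"
  then have "t / h < x / h" "of_int \<lceil>x / h\<rceil> - 1 < t / h" using h by (auto simp: field_simps)
  then have "\<lfloor>t / h\<rfloor> = \<lceil>x / h\<rceil> - 1"
    using le_of_int_ceiling[of "x / h"] by (intro floor_unique) (simp_all, linarith)
  then show "w (nat \<lfloor>t / h\<rfloor>) = w (nat (\<lceil>x / h\<rceil> - 1))" by simp
qed

text \<open>Jumps occur only at multiples of \<open>h\<close>, finitely many in a bounded interval;
  since the index is at most \<open>x / h\<close>, geometric growth in it gives the rate
  \<open>ln q / h\<close>.\<close>

lemma step_function_in_scale_class:
  fixes w :: "nat \<Rightarrow> real"
  assumes h: "0 < h" and w: "\<And>n. 0 \<le> w n" "\<And>n. w n \<le> A * q ^ n" and q: "1 \<le> q"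
  shows "(\<lambda>x. w (nat \<lfloor>x / h\<rfloor>)) \<in> scale_class"
proof -
  let ?W = "\<lambda>x. w (nat \<lfloor>x / h\<rfloor>)"
  have right: "(?W \<longlongrightarrow> ?W x) (at_right x)" for x
    using step_function_at_right[OF h] by (rule tendsto_eventually)
  have left: "(?W \<longlongrightarrow> w (nat (\<lceil>x / h\<rceil> - 1))) (at_left x)" for x
    using step_function_at_left[OF h] by (rule tendsto_eventually)
  have "finite {x \<in> {0..b}. \<not> continuous (at x within {0..}) ?W}" for b
  proof (rule finite_subset)
    show "{x \<in> {0..b}. \<not> continuous (at x within {0..}) ?W} \<subseteq> (\<lambda>k. h * of_int k) ` {0..\<lfloor>b / h\<rfloor>}"
    proof safe
      fix x assume x: "x \<in> {0..b}" and nc: "\<not> continuous (at x within {0..}) ?W"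
      have "x / h = of_int \<lfloor>x / h\<rfloor>"
      proof (rule ccontr)
        assume "x / h \<noteq> of_int \<lfloor>x / h\<rfloor>"
        then have "\<lceil>x / h\<rceil> - 1 = \<lfloor>x / h\<rfloor>" by linarith
        then have "(?W \<longlongrightarrow> ?W x) (at_left x)" using left[of x] by simp
        then have "(?W \<longlongrightarrow> ?W x) (at x)" using right[of x] by (simp add: filterlim_split_at)
        then have "isCont ?W x" by (simp add: isCont_def)
        then show False using nc continuous_at_imp_continuous_at_within by blast
      qed
      then have "x = h * of_int \<lfloor>x / h\<rfloor>" using h by (simp add: field_simps)
      moreover have "\<lfloor>x / h\<rfloor> \<in> {0..\<lfloor>b / h\<rfloor>}"
        using x h by (auto intro!: floor_mono divide_right_mono)
      ultimately show "x \<in> (\<lambda>k. h * of_int k) ` {0..\<lfloor>b / h\<rfloor>}" by (rule image_eqI)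
    qed
  qed simp
  then have "piecewise_continuous ?W"
    using left right unfolding piecewise_continuous_def by blast
  moreover have "exponential_order ?W"
    unfolding exponential_order_def
  proof (intro exI conjI allI impI)
    show "0 \<le> ln q / h" using q h by simp
    have "0 \<le> A" using w(1)[of 0] w(2)[of 0] by simp
    then show "0 \<le> A" .
    fix x :: real assume x: "0 \<le> x"
    let ?n = "nat \<lfloor>x / h\<rfloor>"
    have "real ?n \<le> x / h" using x h by simp
    then have "ln q * real ?n \<le> ln q * (x / h)" using q by (intro mult_left_mono) auto
    have "q ^ ?n = exp (ln q * real ?n)"
      using q by (simp add: exp_of_nat2_mult)
    also have "\<dots> \<le> exp (ln q / h * x)" using \<open>ln q * real ?n \<le> ln q * (x / h)\<close> by simp
    finally show "?W x \<le> A * exp (ln q / h * x)"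
      using w(2)[of ?n] \<open>0 \<le> A\<close> by (meson mult_left_mono order.trans)
  qed
  moreover have "continuous (at_right x) ?W" for x
    using right by (simp add: continuous_within)
  ultimately show ?thesis using w(1) by (simp add: scale_class_def)
qed

theorem theorem4p2:
  fixes M :: "'a measure" and F :: "real \<Rightarrow> 'a measure" and X :: "real \<Rightarrow> 'a \<Rightarrow> real"
    and lam :: "real measure" and h :: real
  assumes "upwards_skip_free_levy_chain M F X lam h"
  defines "W \<equiv> scale_function M X h"
  shows "(\<forall>y\<in>lattice_nonneg h. \<forall>x\<ge>0.
            measure M {\<omega> \<in> space M. running_inf X (passage_time X y \<omega>) \<omega> \<ge> ereal (- x)}
              = W x / W (x + y)) \<and>
         (\<exists>c>0. (\<lambda>x. c * W x) \<in> scale_class \<and>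
            (\<forall>\<beta>>Phi0 lam. has_laplace_transform (\<lambda>x. c * W x) \<beta>
               ((exp (\<beta> * h) - 1) / (\<beta> * h * laplace_exponent lam \<beta>))) \<and>
            (\<forall>g\<in>scale_class.
               (\<forall>\<beta>>Phi0 lam. has_laplace_transform g \<beta>
                  ((exp (\<beta> * h) - 1) / (\<beta> * h * laplace_exponent lam \<beta>))) \<longrightarrow>
               (\<forall>x\<ge>0. g x = c * W x)))"
proof -
  interpret upwards_skip_free_levy_chain M F X lam h by (rule assms(1))
  let ?w = "scale_seq down_pmf"
  have W: "W = (\<lambda>x. ?w (nat \<lfloor>x / h\<rfloor>))" by (simp add: W_def scale_function_eq[abs_def])
  have part1: "measure M {\<omega> \<in> space M. running_inf X (passage_time X y \<omega>) \<omega> \<ge> ereal (- x)} = W x / W (x + y)"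
    if y: "y \<in> lattice_nonneg h" and x: "0 \<le> x" for x y
  proof -
    obtain j where j: "y = h * of_int j" "0 \<le> y" using y by (auto simp: lattice_nonneg_def lattice_def)
    then have "0 \<le> j" using h_pos by (simp add: zero_le_mult_iff)
    then have yk: "y = h * real (nat j)" using j by simp
    have "(x + y) / h = x / h + of_int j" using j h_pos by (simp add: field_simps)
    then have "nat \<lfloor>(x + y) / h\<rfloor> = nat \<lfloor>x / h\<rfloor> + nat j"
      using \<open>0 \<le> j\<close> x h_pos by (simp add: nat_add_distrib)
    then show ?thesis
      using prob_running_inf_ge(2)[OF x, of "nat j"] by (simp add: W yk)
  qed
  \<comment> \<open>This constant cancels the factor \<open>measure lam {h}\<close> in
    \<open>laplace_scale_function\<close> and supplies the missing \<open>1 / h\<close>.\<close>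
  define c where "c = 1 / (h * measure lam {h})"
  have c: "0 < c" using h_pos lam_h_pos by (simp add: c_def)
  have laplace: "has_laplace_transform (\<lambda>x. c * W x) \<beta> ((exp (\<beta> * h) - 1) / (\<beta> * h * laplace_exponent lam \<beta>))"
    if "Phi0 lam < \<beta>" for \<beta>
  proof -
    have "c * (measure lam {h} * (exp (\<beta> * h) - 1) / (\<beta> * laplace_exponent lam \<beta>)) =
        (exp (\<beta> * h) - 1) / (\<beta> * h * laplace_exponent lam \<beta>)"
      using lam_h_pos h_pos by (simp add: c_def)
    then show ?thesis
      using has_laplace_transform_cmult[OF laplace_scale_function[OF that], of c] by (simp add: W_def)
  qed
  have cls: "(\<lambda>x. c * W x) \<in> scale_class"
    unfolding W
  proof (rule step_function_in_scale_class[OF h_pos])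
    show "0 \<le> c * ?w n" for n using c scale_seq_pos[OF down_pmf_0, of n] by simp
    show "c * ?w n \<le> c * (1 / pmf down_pmf 0) ^ n" for n
      using c scale_seq_le[OF down_pmf_0, of n] by (intro mult_left_mono) auto
    show "1 \<le> 1 / pmf down_pmf 0" using down_pmf_0 by (simp add: pmf_le_1)
  qed
  have "g x = c * W x"
    if g: "g \<in> scale_class" and gl: "\<forall>\<beta>>Phi0 lam. has_laplace_transform g \<beta>
      ((exp (\<beta> * h) - 1) / (\<beta> * h * laplace_exponent lam \<beta>))" and x: "0 \<le> x" for g x
  \<comment> \<open>Equal transforms give equality almost everywhere, and right continuity removes
    the exceptional set.\<close>
  proof (rule AE_eq_right_continuous_imp_eq[OF laplace_unique_AE[where b="Phi0 lam"] _ _ x])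
    fix \<beta> assume "Phi0 lam < \<beta>"
    then have l: "has_laplace_transform g \<beta> ((exp (\<beta> * h) - 1) / (\<beta> * h * laplace_exponent lam \<beta>))"
      "has_laplace_transform (\<lambda>x. c * W x) \<beta> ((exp (\<beta> * h) - 1) / (\<beta> * h * laplace_exponent lam \<beta>))"
      using gl laplace by auto
    show "set_integrable lborel {0..} (\<lambda>x. exp (- \<beta> * x) * g x)"
      using l(1) by (simp add: has_laplace_transform_def)
    show "set_integrable lborel {0..} (\<lambda>x. exp (- \<beta> * x) * (c * W x))"
      using l(2) by (simp add: has_laplace_transform_def)
    show "(LBINT x:{0..}. exp (- \<beta> * x) * g x) = (LBINT x:{0..}. exp (- \<beta> * x) * (c * W x))"
      using l by (simp add: has_laplace_transform_def)
  qed (use g cls x in \<open>simp_all add: scale_class_def\<close>)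
  then show ?thesis using part1 c cls laplace by blast
qed

end
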